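(* Let $M$ be a message set such that $G_M$ is an oriented ring. The problem of deciding whether a given $M$-system is synchronizable is decidable.
   Context: A message set $M=(\Sigma_M,N,\mathrm{src},\mathrm{dst})$: finite set of messages, $N\ge1$ peers, $\mathrm{src}(a)\neq\mathrm{dst}(a)\in\{1,\dots,N\}$. Its communication topology $G_M$ is the directed graph on $\{1,\dots,N\}$ with an edge $i\to j$ iff some message $a$ has $\mathrm{src}(a)=i$, $\mathrm{dst}(a)=j$; $G_M$ is an oriented ring if its edge set is exactly $\{(i,j)\mid j=i+1 \bmod N\}$. Actions $!a$ (by peer $\mathrm{src}(a)$), $?a$ (by peer $\mathrm{dst}(a)$); traces are finite action sequences; $!?a$ abbreviates $!a\cdot?a$. For a trace $\tau$, $\pi_!(\tau)$ is the sequence of sent messages; $\mathrm{buf}_{i\to j}(\tau)$ is the word $w$ (if any) with (sent on $i\to j$) $=$ (received on $i\to j$)$\cdot w$. $\tau$ is FIFO ($k$-bounded FIFO) if for all $i,j$ and prefixes $\tau'$, $\mathrm{buf}_{i\to j}(\tau')$ is defined (and has length $\le k$); synchronous if of the form $!?a_1\cdots!?a_k$. An $M$-system $S=(P_1,\dots,P_N)$: finite automata $P_i$ (all states accepting) over actions of peer $i$, with one FIFO channel per ordered pair $i\neq j$. A configuration: one control state per peer and contents $w_{i,j}$ of channels; stable if all channels empty. $!a$ ($\mathrm{src}(a)=i,\mathrm{dst}(a)=j$) moves $P_i$ and appends $a$ to $w_{i,j}$; $?a$ moves $P_j$ and removes $a$ from the head of $w_{i,j}$; $c_0$ is the initial configuration.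 $T_k(S)$ ($k\ge1$): $k$-bounded FIFO traces $\tau$ with $c_0\xrightarrow{\tau}c$ for some $c$; $T_0(S)$: synchronous such traces; $T_\omega(S)=\bigcup_kT_k(S)$. $ST_k(S)=\{\pi_!(\tau)\mid\tau\in T_k(S)\}\cup\{(\pi_!(\tau),c)\mid c_0\xrightarrow{\tau}c,\ c\text{ stable},\ \tau\in T_k(S)\}$. $S$ is synchronizable if $ST_0(S)=ST_\omega(S)$. *)

theory Defs
  imports Main "HOL-Library.Nat_Bijection" "HOL-Library.Sublist"
begin

datatype recf = Zero | Succ | Proj nat | Comp recf "recf list" | PrimRec recf recf | Mu recf

inductive rec_eval :: "recf \<Rightarrow> nat list \<Rightarrow> nat \<Rightarrow> bool" where
  ev_zero: "rec_eval Zero xs 0"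
| ev_succ: "rec_eval Succ (x # xs) (Suc x)"
| ev_proj: "i < length xs \<Longrightarrow> rec_eval (Proj i) xs (xs ! i)"
| ev_comp: "list_all2 (\<lambda>g y. rec_eval g xs y) gs ys \<Longrightarrow> rec_eval f ys z \<Longrightarrow> rec_eval (Comp f gs) xs z"
| ev_pr0: "rec_eval g xs z \<Longrightarrow> rec_eval (PrimRec g h) (0 # xs) z"
| ev_prS: "rec_eval (PrimRec g h) (n # xs) y \<Longrightarrow> rec_eval h (y # n # xs) z
            \<Longrightarrow> rec_eval (PrimRec g h) (Suc n # xs) z"
| ev_mu: "rec_eval f (n # xs) 0 \<Longrightarrow> (\<forall>m<n. \<exists>y. rec_eval f (m # xs) (Suc y))
            \<Longrightarrow> rec_eval (Mu f) xs n"

datatype act = Snd nat | Rcv nat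

text \<open>An instance: number of peers N; the message set as a list of triples (message, src, dst);
  for each peer i (stored at index i-1) its automaton as (initial state, transition list).
  States are natural numbers; all states are accepting.\<close>
record inst =
  npeers :: nat
  msgs :: "(nat \<times> nat \<times> nat) list"
  peers :: "(nat \<times> (nat \<times> act \<times> nat) list) list"

definition msg_set :: "inst \<Rightarrow> nat set" where
  "msg_set I = fst ` set (msgs I)"

definition src :: "inst \<Rightarrow> nat \<Rightarrow> nat" where
  "src I a = fst (the (map_of (msgs I) a))"

definition dst :: "inst \<Rightarrow> nat \<Rightarrow> nat" where
  "dst I a = snd (the (map_of (msgs I) a))"

definition peer_acts :: "inst \<Rightarrow> nat \<Rightarrow> act set" where
  "peer_acts I i = {Snd a | a. a \<in> msg_set I \<and> src I a = i} \<union> {Rcv a | a. a \<in> msg_set I \<and> dst I a = i}"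

definition init_st :: "inst \<Rightarrow> nat \<Rightarrow> nat" where
  "init_st I i = fst (peers I ! (i - 1))"

definition trans :: "inst \<Rightarrow> nat \<Rightarrow> (nat \<times> act \<times> nat) set" where
  "trans I i = set (snd (peers I ! (i - 1)))"

definition valid_inst :: "inst \<Rightarrow> bool" where
  "valid_inst I \<longleftrightarrow> npeers I \<ge> 1 \<and> distinct (map fst (msgs I))
     \<and> (\<forall>(a, s, d) \<in> set (msgs I). s \<noteq> d \<and> s \<in> {1..npeers I} \<and> d \<in> {1..npeers I})
     \<and> length (peers I) = npeers I
     \<and> (\<forall>i \<in> {1..npeers I}. \<forall>(q, x, q') \<in> trans I i. x \<in> peer_acts I i)"

definition topology :: "inst \<Rightarrow> (nat \<times> nat) set" where
  "topology I = {(src I a, dst I a) | a. a \<in> msg_set I}"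

definition oriented_ring :: "inst \<Rightarrow> bool" where
  "oriented_ring I \<longleftrightarrow> topology I = {(i, i mod npeers I + 1) | i. i \<in> {1..npeers I}}"

type_synonym config = "(nat \<Rightarrow> nat) \<times> (nat \<Rightarrow> nat \<Rightarrow> nat list)"

definition c0 :: "inst \<Rightarrow> config" where
  "c0 I = ((\<lambda>i. if i \<in> {1..npeers I} then init_st I i else 0), (\<lambda>i j. []))"

definition stable :: "config \<Rightarrow> bool" where
  "stable c \<longleftrightarrow> (\<forall>i j. snd c i j = [])"

inductive step :: "inst \<Rightarrow> config \<Rightarrow> act \<Rightarrow> config \<Rightarrow> bool" for I where
  step_snd: "a \<in> msg_set I \<Longrightarrow> i = src I a \<Longrightarrow> j = dst I a \<Longrightarrow> (st i, Snd a, q') \<in> trans I i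
     \<Longrightarrow> step I (st, ch) (Snd a) (st(i := q'), ch(i := (ch i)(j := ch i j @ [a])))"
| step_rcv: "a \<in> msg_set I \<Longrightarrow> i = src I a \<Longrightarrow> j = dst I a \<Longrightarrow> (st j, Rcv a, q') \<in> trans I j
     \<Longrightarrow> ch i j = a # w
     \<Longrightarrow> step I (st, ch) (Rcv a) (st(j := q'), ch(i := (ch i)(j := w)))"

inductive reach :: "inst \<Rightarrow> config \<Rightarrow> act list \<Rightarrow> config \<Rightarrow> bool" for I where
  reach_nil: "reach I c [] c"
| reach_cons: "step I c x c' \<Longrightarrow> reach I c' xs c'' \<Longrightarrow> reach I c (x # xs) c''"

fun sends :: "act list \<Rightarrow> nat list" where
  "sends [] = []"
| "sends (Snd a # xs) = a # sends xs"
| "sends (Rcv a # xs) = sends xs"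

definition sent_on :: "inst \<Rightarrow> nat \<Rightarrow> nat \<Rightarrow> act list \<Rightarrow> nat list" where
  "sent_on I i j t = [a. Snd a \<leftarrow> t, src I a = i \<and> dst I a = j]"

definition recv_on :: "inst \<Rightarrow> nat \<Rightarrow> nat \<Rightarrow> act list \<Rightarrow> nat list" where
  "recv_on I i j t = [a. Rcv a \<leftarrow> t, src I a = i \<and> dst I a = j]"

text \<open>buf_{i->j}(t) is defined iff the received word is a prefix of the sent word.\<close>
definition bounded_fifo :: "inst \<Rightarrow> nat \<Rightarrow> act list \<Rightarrow> bool" where
  "bounded_fifo I k t \<longleftrightarrow> (\<forall>t' i j. prefix t' t \<longrightarrow>
      prefix (recv_on I i j t') (sent_on I i j t')
      \<and> length (sent_on I i j t') - length (recv_on I i j t') \<le> k)"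

definition synchronous :: "act list \<Rightarrow> bool" where
  "synchronous t \<longleftrightarrow> (\<exists>as. t = concat (map (\<lambda>a. [Snd a, Rcv a]) as))"

definition T :: "inst \<Rightarrow> nat \<Rightarrow> act list set" where
  "T I k = {t. (if k = 0 then synchronous t else bounded_fifo I k t) \<and> (\<exists>c. reach I (c0 I) t c)}"

definition T_omega :: "inst \<Rightarrow> act list set" where
  "T_omega I = (\<Union>k. T I k)"

definition ST_of :: "inst \<Rightarrow> act list set \<Rightarrow> (nat list + (nat list \<times> config)) set" where
  "ST_of I Ts = Inl ` (sends ` Ts)
     \<union> {Inr (sends t, c) | t c. t \<in> Ts \<and> reach I (c0 I) t c \<and> stable c}"

definition synchronizable :: "inst \<Rightarrow> bool" where
  "synchronizable I \<longleftrightarrow> ST_of I (T I 0) = ST_of I (T_omega I)"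

fun enc_act :: "act \<Rightarrow> nat" where
  "enc_act (Snd a) = 2 * a"
| "enc_act (Rcv a) = 2 * a + 1"

definition enc_inst :: "inst \<Rightarrow> nat" where
  "enc_inst I = list_encode
     [npeers I,
      list_encode (map (\<lambda>(a, s, d). list_encode [a, s, d]) (msgs I)),
      list_encode (map (\<lambda>(q, ts). list_encode [q,
          list_encode (map (\<lambda>(p, x, p'). list_encode [p, enc_act x, p']) ts)]) (peers I))]"

end

(*
In an oriented ring every peer sends on one channel and receives on one channel, so two messages
have the same source iff they have the same destination.  Let D(u) be the family of sets of local
states that the peers can be in after the synchronous exchange of u.  S is synchronizable iff
every D(u) without an empty component satisfies three conditions on at most two further messages:
(1) an enabled send can be received; (2) two enabled exchanges with different sources are compatible;
(3) whatever a peer reaches by sending b and then receiving a, it also reaches by receiving a first.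
They express that some short asynchronous continuations of u are matched by synchronous ones.
Conversely they suffice: a peer that sends s1 ... sp before receiving a can receive a
first, by moving the reception over the sends one at a time (2 makes the intermediate synchronous
traces available, 3 performs the swap), and this turns any FIFO trace into the synchronous trace
with the same sends.

D(u) ranges over a finite set, so a finite set of families closed under one exchange certifies
synchronizability, and a word u with a bad D(u) refutes it; unbounded search for either decides.
*)
theory Submission
  imports Defs
begin

section \<open>Traces and local runs\<close>

fun msg_of :: "act \<Rightarrow> nat" where
  "msg_of (Snd a) = a"
| "msg_of (Rcv a) = a"

fun actor :: "inst \<Rightarrow> act \<Rightarrow> nat" where
  "actor I (Snd a) = src I a"
| "actor I (Rcv a) = dst I a"

definition post :: "(nat \<times> act \<times> nat) set \<Rightarrow> nat set \<Rightarrow> act \<Rightarrow> nat set" where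
  "post R Q x = {q'. \<exists>q\<in>Q. (q, x, q') \<in> R}"

text \<open>Subset construction: the automata are nondeterministic, so a word leads to a set of
  states, which is empty exactly when the peer cannot perform \<open>w\<close>.\<close>

definition after :: "inst \<Rightarrow> nat \<Rightarrow> act list \<Rightarrow> nat set" where
  "after I i w = foldl (post (trans I i)) {init_st I i} w"

definition local_word :: "inst \<Rightarrow> nat \<Rightarrow> act list \<Rightarrow> act list" where
  "local_word I i t = filter (\<lambda>x. actor I x = i) t"

text \<open>FIFO without a bound. A finite trace is bounded by its own length, so this describes the
  traces that are FIFO for some bound.\<close>

definition fifo :: "inst \<Rightarrow> act list \<Rightarrow> bool" where
  "fifo I t \<longleftrightarrow> (\<forall>t' i j. prefix t' t \<longrightarrow> prefix (recv_on I i j t') (sent_on I i j t'))"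

lemma post_mono: "Q \<subseteq> Q' \<Longrightarrow> post R Q x \<subseteq> post R Q' x"
  by (auto simp: post_def)

lemma post_empty [simp]: "post R {} x = {}"
  by (simp add: post_def)

lemma after_Nil [simp]: "after I i [] = {init_st I i}"
  by (simp add: after_def)

lemma after_snoc [simp]: "after I i (w @ [x]) = post (trans I i) (after I i w) x"
  by (simp add: after_def)

lemma local_word_Nil [simp]: "local_word I i [] = []"
  by (simp add: local_word_def)

lemma local_word_append [simp]: "local_word I i (t @ t') = local_word I i t @ local_word I i t'"
  by (simp add: local_word_def)

lemma local_word_Cons [simp]:
  "local_word I i (x # t) = (if actor I x = i then [x] else []) @ local_word I i t"
  by (simp add: local_word_def)

lemma sent_on_simps [simp]:
  "sent_on I i j [] = []"
  "sent_on I i j (Snd a # t) = (if src I a = i \<and> dst I a = j then [a] else []) @ sent_on I i j t"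
  "sent_on I i j (Rcv a # t) = sent_on I i j t"
  "sent_on I i j (t @ t') = sent_on I i j t @ sent_on I i j t'"
  by (simp_all add: sent_on_def)

lemma recv_on_simps [simp]:
  "recv_on I i j [] = []"
  "recv_on I i j (Snd a # t) = recv_on I i j t"
  "recv_on I i j (Rcv a # t) = (if src I a = i \<and> dst I a = j then [a] else []) @ recv_on I i j t"
  "recv_on I i j (t @ t') = recv_on I i j t @ recv_on I i j t'"
  by (simp_all add: recv_on_def)

lemma sends_append [simp]: "sends (t @ t') = sends t @ sends t'"
  by (induction t rule: sends.induct) auto

lemma set_sends: "set (sends t) = {a. Snd a \<in> set t}"
  by (induction t rule: sends.induct) auto

lemma sent_on_sends: "sent_on I i j t = filter (\<lambda>a. src I a = i \<and> dst I a = j) (sends t)"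
  by (induction t rule: sends.induct) auto

lemma fifo_Nil [simp]: "fifo I []"
  by (simp add: fifo_def)

lemma fifo_snoc:
  "fifo I (t @ [x]) \<longleftrightarrow> fifo I t \<and> (\<forall>i j. prefix (recv_on I i j (t @ [x])) (sent_on I i j (t @ [x])))"
  unfolding fifo_def by (auto simp: prefix_snoc simp del: sent_on_simps recv_on_simps)

lemma fifo_prefixD: "fifo I t \<Longrightarrow> prefix (recv_on I i j t) (sent_on I i j t)"
  unfolding fifo_def by blast

lemma fifo_snoc_Snd [simp]: "fifo I (t @ [Snd a]) \<longleftrightarrow> fifo I t"
  unfolding fifo_snoc by (auto simp: fifo_prefixD)

lemma length_sent_on_le: "length (sent_on I i j t) \<le> length t"
proof (induction t)
  case (Cons x t)
  then show ?case by (cases x) auto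
qed simp

text \<open>No channel ever holds more messages than the trace has actions. The successor keeps the
  bound positive, because the index 0 of \<open>T\<close> stands for the synchronous traces.\<close>

lemma fifo_imp_bounded:
  assumes "fifo I t" shows "bounded_fifo I (Suc (length t)) t"
  unfolding bounded_fifo_def
proof (intro allI impI conjI)
  fix t' i j
  assume t': "prefix t' t"
  show "prefix (recv_on I i j t') (sent_on I i j t')"
    using assms t' by (auto simp: fifo_def)
  have "length (sent_on I i j t') \<le> length t"
    using length_sent_on_le prefix_length_le[OF t'] order_trans by blast
  then show "length (sent_on I i j t') - length (recv_on I i j t') \<le> Suc (length t)" by simp
qed

section \<open>Global runs as independent local runs\<close>

inductive_cases reach_NilE: "reach I c [] c'"
inductive_cases reach_ConsE: "reach I c (x # t) c'"

lemma reach_Nil_iff: "reach I c [] c' \<longleftrightarrow> c' = c"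
  by (blast intro: reach.intros elim: reach_NilE)

lemma reach_Cons_iff: "reach I c (x # t) c'' \<longleftrightarrow> (\<exists>c'. step I c x c' \<and> reach I c' t c'')"
  by (blast intro: reach.intros elim: reach_ConsE)

lemma reach_snoc: "reach I c (t @ [x]) c'' \<longleftrightarrow> (\<exists>c'. reach I c t c' \<and> step I c' x c'')"
proof (induction t arbitrary: c)
  case Nil
  show ?case by (simp add: reach_Nil_iff reach_Cons_iff del: split_paired_Ex)
next
  case (Cons y t)
  then show ?case by (simp only: append_Cons reach_Cons_iff) blast
qed

lemma step_Snd_iff:
  "step I c (Snd a) c' \<longleftrightarrow> a \<in> msg_set I \<and> (\<exists>q'. (fst c (src I a), Snd a, q') \<in> trans I (src I a) \<and>
     c' = ((fst c)(src I a := q'),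
           (snd c)(src I a := (snd c (src I a))(dst I a := snd c (src I a) (dst I a) @ [a]))))"
  by (cases c) (auto elim!: step.cases intro: step.intros)

lemma step_Rcv_iff:
  "step I c (Rcv a) c' \<longleftrightarrow> a \<in> msg_set I \<and> (\<exists>q' w. (fst c (dst I a), Rcv a, q') \<in> trans I (dst I a) \<and>
     snd c (src I a) (dst I a) = a # w \<and>
     c' = ((fst c)(dst I a := q'), (snd c)(src I a := (snd c (src I a))(dst I a := w))))"
  by (cases c) (auto elim!: step.cases intro: step.intros)

text \<open>Each peer of a ring has one outgoing and one incoming channel. The locale records this
  as \<open>same_channel\<close>: two messages share a source iff they share a destination.\<close>

locale ring_system =
  fixes I :: inst
  assumes valid: "valid_inst I"
    and same_channel: "\<lbrakk>a \<in> msg_set I; b \<in> msg_set I\<rbrakk> \<Longrightarrow> src I a = src I b \<longleftrightarrow> dst I a = dst I b"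
begin

abbreviation "M \<equiv> msg_set I"
abbreviation "N \<equiv> npeers I"

lemma msg_props:
  assumes "a \<in> M"
  shows "src I a \<in> {1..N}" "dst I a \<in> {1..N}" "src I a \<noteq> dst I a"
proof -
  obtain p where p: "(a, p) \<in> set (msgs I)" using assms by (auto simp: msg_set_def)
  then have "map_of (msgs I) a = Some p" using valid by (simp add: valid_inst_def)
  then have "src I a = fst p" "dst I a = snd p" by (auto simp: src_def dst_def)
  moreover have "fst p \<noteq> snd p \<and> fst p \<in> {1..N} \<and> snd p \<in> {1..N}"
    using p valid by (auto simp: valid_inst_def)
  ultimately show "src I a \<in> {1..N}" "dst I a \<in> {1..N}" "src I a \<noteq> dst I a" by auto
qed

lemma trans_props:
  assumes "i \<in> {1..N}" "(q, x, q') \<in> trans I i"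
  shows "msg_of x \<in> M" "actor I x = i"
  using assms valid unfolding valid_inst_def peer_acts_def by fastforce+

text \<open>Peers interact only through the channels. For a fixed trace the channel contents are
  therefore forced, and the control states can be chosen separately, each from the set that the
  peer's own local word reaches. The value 0 outside the peers is the default of
  \<open>c0\<close>.\<close>

lemma reach_iff:
  "reach I (c0 I) t c \<longleftrightarrow> msg_of ` set t \<subseteq> M \<and> (\<forall>i\<in>{1..N}. fst c i \<in> after I i (local_word I i t)) \<and>
     (\<forall>i. i \<notin> {1..N} \<longrightarrow> fst c i = 0) \<and> fifo I t \<and>
     (\<forall>i j. sent_on I i j t = recv_on I i j t @ snd c i j)"
proof (induction t arbitrary: c rule: rev_induct)
  case Nil
  have "reach I (c0 I) [] c \<longleftrightarrow> c = c0 I"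
    by (simp add: reach_Nil_iff)
  also have "\<dots> \<longleftrightarrow> (\<forall>i\<in>{1..N}. fst c i = init_st I i) \<and> (\<forall>i. i \<notin> {1..N} \<longrightarrow> fst c i = 0) \<and> (\<forall>i j. snd c i j = [])"
    by (cases c) (auto simp: c0_def fun_eq_iff)
  finally show ?case by auto
next
  case (snoc x t)
  show ?case
  proof (cases x)
    case (Snd a)
    let ?i = "src I a" and ?j = "dst I a"
    show ?thesis (is "?L \<longleftrightarrow> ?R")
    proof
      assume ?L
      then show ?R
        unfolding reach_snoc step_Snd_iff snoc.IH Snd
        using msg_props by (auto simp: post_def)
    next
      assume R: ?R
      have a: "a \<in> M" using R Snd by auto
      note aa = msg_props[OF a]
      have "fst c ?i \<in> post (trans I ?i) (after I ?i (local_word I ?i t)) (Snd a)"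
        using R[THEN conjunct2, THEN conjunct1, rule_format, of ?i] Snd aa by simp
      then obtain q where q: "q \<in> after I ?i (local_word I ?i t)" "(q, Snd a, fst c ?i) \<in> trans I ?i"
        by (auto simp: post_def)
      obtain w where w: "prefix (recv_on I ?i ?j t) (sent_on I ?i ?j t)" "sent_on I ?i ?j t = recv_on I ?i ?j t @ w"
        using R Snd fifo_prefixD by (metis fifo_snoc_Snd prefixE)
      have cij: "snd c ?i ?j = w @ [a]"
        using R[THEN conjunct2, THEN conjunct2, THEN conjunct2, THEN conjunct2, rule_format, of ?i ?j] w(2) Snd by simp
      \<comment> \<open>The configuration before the send: the sender goes back to a predecessor
        \<open>q\<close>, and its channel loses the last message.\<close>
      define c' where "c' = ((fst c)(?i := q), (snd c)(?i := (snd c ?i)(?j := w)))"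
      have "reach I (c0 I) t c'"
        unfolding snoc.IH using R Snd q aa w(2) by (auto simp: c'_def split: if_splits)
      moreover have "step I c' (Snd a) c"
        unfolding step_Snd_iff using a q(2) cij by (cases c) (auto simp: c'_def fun_eq_iff)
      ultimately show ?L unfolding reach_snoc Snd by blast
    qed
  next
    case (Rcv a)
    let ?i = "src I a" and ?j = "dst I a"
    show ?thesis (is "?L \<longleftrightarrow> ?R")
    proof
      assume ?L
      then obtain c' q' w where c': "reach I (c0 I) t c'" "a \<in> M" "(fst c' ?j, Rcv a, q') \<in> trans I ?j"
        "snd c' ?i ?j = a # w" "c = ((fst c')(?j := q'), (snd c')(?i := (snd c' ?i)(?j := w)))"
        unfolding reach_snoc step_Rcv_iff Rcv by blast
      note IH = c'(1)[unfolded snoc.IH]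
      have s: "sent_on I i j t = recv_on I i j t @ snd c' i j" for i j using IH by blast
      have "fifo I (t @ [Rcv a])"
        unfolding fifo_snoc using IH s c'(4) by auto
      then show ?R
        using IH s msg_props[OF c'(2)] c' Rcv by (auto simp: post_def)
    next
      assume R: ?R
      have a: "a \<in> M" using R Rcv by auto
      note aa = msg_props[OF a]
      have "fst c ?j \<in> post (trans I ?j) (after I ?j (local_word I ?j t)) (Rcv a)"
        using R[THEN conjunct2, THEN conjunct1, rule_format, of ?j] Rcv aa by simp
      then obtain q where q: "q \<in> after I ?j (local_word I ?j t)" "(q, Rcv a, fst c ?j) \<in> trans I ?j"
        by (auto simp: post_def)
      have s: "sent_on I ?i ?j t = recv_on I ?i ?j t @ a # snd c ?i ?j"
        using R[THEN conjunct2, THEN conjunct2, THEN conjunct2, THEN conjunct2, rule_format, of ?i ?j] Rcv by simp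
      \<comment> \<open>Undoing the reception puts \<open>a\<close> back at the head of the
        channel.\<close>
      define c' where "c' = ((fst c)(?j := q), (snd c)(?i := (snd c ?i)(?j := a # snd c ?i ?j)))"
      have "fifo I t" using R by (simp add: fifo_snoc)
      then have "reach I (c0 I) t c'"
        unfolding snoc.IH using R Rcv q aa s by (auto simp: c'_def split: if_splits)
      moreover have "step I c' (Rcv a) c"
        unfolding step_Rcv_iff using a q(2) by (cases c) (auto simp: c'_def fun_eq_iff)
      ultimately show ?L unfolding reach_snoc Rcv by blast
    qed
  qed
qed

end

section \<open>Synchronous words and the conditions on state families\<close>

fun rcvs :: "act list \<Rightarrow> nat list" where
  "rcvs [] = []"
| "rcvs (Snd a # xs) = rcvs xs"
| "rcvs (Rcv a # xs) = a # rcvs xs"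

lemma rcvs_append [simp]: "rcvs (t @ t') = rcvs t @ rcvs t'"
  by (induction t rule: rcvs.induct) auto

lemma set_rcvs: "set (rcvs t) = {a. Rcv a \<in> set t}"
  by (induction t rule: rcvs.induct) auto

lemma recv_on_rcvs: "recv_on I i j t = filter (\<lambda>a. src I a = i \<and> dst I a = j) (rcvs t)"
  by (induction t rule: rcvs.induct) auto

definition syn :: "nat list \<Rightarrow> act list" where
  "syn u = concat (map (\<lambda>a. [Snd a, Rcv a]) u)"

lemma syn_simps [simp]: "syn [] = []" "syn (a # u) = Snd a # Rcv a # syn u" "syn (u @ v) = syn u @ syn v"
  by (simp_all add: syn_def)

lemma sends_syn [simp]: "sends (syn u) = u" and rcvs_syn [simp]: "rcvs (syn u) = u"
  by (induction u) auto

lemma synchronous_iff: "synchronous t \<longleftrightarrow> (\<exists>u. t = syn u)"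
  by (simp add: synchronous_def syn_def)

lemma fifo_syn: "fifo I (syn u)"
proof (induction u rule: rev_induct)
  case (snoc a u)
  have "fifo I ((syn u @ [Snd a]) @ [Rcv a])"
    using snoc unfolding fifo_snoc by (auto simp: sent_on_sends recv_on_rcvs)
  then show ?case by simp
qed simp

abbreviation posts :: "(nat \<times> act \<times> nat) set \<Rightarrow> nat set \<Rightarrow> act list \<Rightarrow> nat set" where
  "posts R \<equiv> foldl (post R)"

lemma posts_empty [simp]: "posts R {} w = {}"
  by (induction w) auto

lemma after_append: "after I i (w @ w') = posts (trans I i) (after I i w) w'"
  by (simp add: after_def)

definition sync_step :: "inst \<Rightarrow> (nat \<Rightarrow> nat set) \<Rightarrow> nat \<Rightarrow> (nat \<Rightarrow> nat set)" where
  "sync_step I D a = (\<lambda>i. if i = src I a then post (trans I i) (D i) (Snd a)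
     else if i = dst I a then post (trans I i) (D i) (Rcv a) else D i)"

text \<open>This is the family D(u). By the independence of the local runs, such a family describes
  the configurations reached by a synchronous trace without loss.\<close>

definition sync_states :: "inst \<Rightarrow> nat list \<Rightarrow> (nat \<Rightarrow> nat set)" where
  "sync_states I u = foldl (sync_step I) (\<lambda>i. {init_st I i}) u"

text \<open>Components at indices that are not peers carry meaningless values and are
  ignored.\<close>

definition live :: "inst \<Rightarrow> (nat \<Rightarrow> nat set) \<Rightarrow> bool" where
  "live I D \<longleftrightarrow> (\<forall>i\<in>{1..npeers I}. D i \<noteq> {})"

text \<open>The clauses come from appending \<open>[Snd a]\<close>, \<open>[Snd a, Snd b]\<close>
  and \<open>[Snd a, Snd b, Rcv a, Rcv b]\<close> to a synchronous trace. In the last one the peer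
  \<open>src I b\<close> sends \<open>b\<close> before it receives \<open>a\<close>, and it must end
  in states that it also reaches by exchanging \<open>a\<close> and then \<open>b\<close>.\<close>

definition good :: "inst \<Rightarrow> (nat \<Rightarrow> nat set) \<Rightarrow> bool" where
  "good I D \<longleftrightarrow> (live I D \<longrightarrow>
     (\<forall>a\<in>msg_set I. post (trans I (src I a)) (D (src I a)) (Snd a) \<noteq> {} \<longrightarrow> live I (sync_step I D a)) \<and>
     (\<forall>a\<in>msg_set I. \<forall>b\<in>msg_set I. src I a \<noteq> src I b \<longrightarrow> live I (sync_step I D a) \<longrightarrow> live I (sync_step I D b) \<longrightarrow>
        live I (sync_step I (sync_step I D a) b)) \<and>
     (\<forall>a\<in>msg_set I. \<forall>b\<in>msg_set I. dst I a = src I b \<longrightarrow> live I (sync_step I D a) \<longrightarrow>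
        posts (trans I (src I b)) (D (src I b)) [Snd b, Rcv a] \<subseteq> sync_step I (sync_step I D a) b (src I b)))"

lemma sync_states_Nil [simp]: "sync_states I [] = (\<lambda>i. {init_st I i})"
  by (simp add: sync_states_def)

lemma sync_states_snoc: "sync_states I (u @ [a]) = sync_step I (sync_states I u) a"
  by (simp add: sync_states_def)

lemma sync_states_snoc2: "sync_states I (u @ [a, b]) = sync_step I (sync_step I (sync_states I u) a) b"
  by (simp add: sync_states_def)

lemma sync_step_empty: "D i = {} \<Longrightarrow> sync_step I D a i = {}"
  by (auto simp: sync_step_def)

lemma live_sync_step: "live I (sync_step I D a) \<Longrightarrow> live I D"
  unfolding live_def using sync_step_empty by blast

text \<open>An empty component stays empty under every further exchange.\<close>

lemma live_appendD: "live I (sync_states I (u @ v)) \<Longrightarrow> live I (sync_states I u)"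
proof (induction v rule: rev_induct)
  case (snoc a v)
  then show ?case using live_sync_step by (simp add: sync_states_snoc flip: append_assoc)
qed simp

text \<open>The local word of peer \<open>i\<close> when the messages of \<open>u\<close> are exchanged in order but the peer
  only receives the first \<open>n\<close> messages that are addressed to it.\<close>

fun partial_word :: "inst \<Rightarrow> nat \<Rightarrow> nat \<Rightarrow> nat list \<Rightarrow> act list" where
  "partial_word I i n [] = []"
| "partial_word I i n (a # u) = (if src I a = i then Snd a # partial_word I i n u
     else if dst I a = i then (case n of 0 \<Rightarrow> partial_word I i 0 u | Suc m \<Rightarrow> Rcv a # partial_word I i m u)
     else partial_word I i n u)"

lemma partial_word_0: "partial_word I i 0 u = map Snd (filter (\<lambda>a. src I a = i) u)"
  by (induction u) auto

context ring_system
begin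

abbreviation "states \<equiv> sync_states I"

text \<open>An exchange contributes one action to its source and one to its destination. These are
  different peers, so no peer performs both.\<close>

lemma states_after: "set u \<subseteq> M \<Longrightarrow> states u i = after I i (local_word I i (syn u))"
proof (induction u arbitrary: i rule: rev_induct)
  case (snoc a u)
  then have "src I a \<noteq> dst I a" using msg_props by simp
  with snoc show ?case
    by (auto simp: sync_states_snoc sync_step_def simp flip: append_assoc)
qed simp

lemma states_sends:
  assumes "\<forall>a\<in>set s. src I a = i"
  shows "states (u @ s) i = posts (trans I i) (states u i) (map Snd s)"
  using assms
proof (induction s rule: rev_induct)
  case (snoc a s)
  then show ?case by (simp add: sync_states_snoc sync_step_def flip: append_assoc)
qed simp

lemma partial_word_full:
  "\<lbrakk>set u \<subseteq> M; length (filter (\<lambda>a. dst I a = i) u) \<le> n\<rbrakk> \<Longrightarrow> partial_word I i n u = local_word I i (syn u)"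
proof (induction u arbitrary: n)
  case (Cons a u)
  then show ?case using msg_props[of a] by (cases n) (auto split: if_splits)
qed simp

text \<open>Raising the number of receptions by one inserts a single \<open>Rcv b\<close>. Before
  its place the peer has received everything in synchronous order, and behind it there are only
  sends; so comparing the two words means moving a reception over a block of sends.\<close>

lemma partial_word_split:
  "\<lbrakk>set u \<subseteq> M; n < length (filter (\<lambda>a. dst I a = i) u)\<rbrakk> \<Longrightarrow>
   \<exists>u1 b u2. u = u1 @ b # u2 \<and> dst I b = i \<and> b = filter (\<lambda>a. dst I a = i) u ! n \<and>
     partial_word I i n u = local_word I i (syn u1) @ map Snd (filter (\<lambda>a. src I a = i) u2) \<and>
     partial_word I i (Suc n) u = local_word I i (syn u1) @ Rcv b # map Snd (filter (\<lambda>a. src I a = i) u2)"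
proof (induction u arbitrary: n)
  case (Cons a u)
  have a: "src I a \<noteq> dst I a" using Cons.prems msg_props by simp
  show ?case
  proof (cases "dst I a = i \<and> n = 0")
    case True
    then show ?thesis using a by (intro exI[of _ "[]"] exI[of _ a] exI[of _ u]) (simp add: partial_word_0)
  next
    case False
    \<comment> \<open>The number of receptions that remain once the head \<open>a\<close> has been
      treated.\<close>
    define m where "m = (if dst I a = i then n - 1 else n)"
    have "m < length (filter (\<lambda>a. dst I a = i) u)"
      using Cons.prems(2) False by (auto simp: m_def split: if_splits)
    then obtain u1 b u2 where *: "u = u1 @ b # u2" "dst I b = i" "b = filter (\<lambda>a. dst I a = i) u ! m"
      "partial_word I i m u = local_word I i (syn u1) @ map Snd (filter (\<lambda>a. src I a = i) u2)"
      "partial_word I i (Suc m) u = local_word I i (syn u1) @ Rcv b # map Snd (filter (\<lambda>a. src I a = i) u2)"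
      using Cons by auto metis
    have n: "dst I a = i \<Longrightarrow> n = Suc m" "dst I a \<noteq> i \<Longrightarrow> n = m" using False by (auto simp: m_def)
    have "a # u = (a # u1) @ b # u2" using *(1) by simp
    moreover have "b = filter (\<lambda>a. dst I a = i) (a # u) ! n" using *(3) n by auto
    moreover have "partial_word I i n (a # u) = local_word I i (syn (a # u1)) @ map Snd (filter (\<lambda>a. src I a = i) u2)"
      using *(4) n a by (cases "dst I a = i") auto
    moreover have "partial_word I i (Suc n) (a # u) = local_word I i (syn (a # u1)) @ Rcv b # map Snd (filter (\<lambda>a. src I a = i) u2)"
      using *(5) n a by (cases "dst I a = i") auto
    ultimately show ?thesis using *(2) by blast
  qed
qed simp

text \<open>The earlier messages addressed to \<open>i\<close> already use up the \<open>n\<close>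
  receptions, so the last message can only contribute a send.\<close>

lemma partial_word_snoc:
  "\<lbrakk>set u \<subseteq> M; n \<le> length (filter (\<lambda>a. dst I a = i) u)\<rbrakk> \<Longrightarrow>
   partial_word I i n (u @ [a]) = partial_word I i n u @ (if src I a = i then [Snd a] else [])"
proof (induction u arbitrary: n)
  case (Cons b u)
  then show ?case using msg_props[of b] by (cases n) (auto split: if_splits simp: partial_word_0)
qed auto

text \<open>All messages to \<open>i\<close> travel on the same channel, hence the FIFO order of
  that channel is an order on everything that \<open>i\<close> receives.\<close>

lemma fifo_into:
  assumes "fifo I t" "msg_of ` set t \<subseteq> M"
  shows "prefix (filter (\<lambda>a. dst I a = i) (rcvs t)) (filter (\<lambda>a. dst I a = i) (sends t))"
proof (cases "\<exists>a\<in>M. dst I a = i")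
  case True
  then obtain a where a: "a \<in> M" "dst I a = i" by blast
  have M: "set (rcvs t) \<subseteq> M" "set (sends t) \<subseteq> M" using assms(2) by (force simp: set_rcvs set_sends)+
  have eq: "filter (\<lambda>b. src I b = src I a \<and> dst I b = i) l = filter (\<lambda>b. dst I b = i) l" if "set l \<subseteq> M" for l
    using that a same_channel by (intro filter_cong) auto
  from fifo_prefixD[OF assms(1), of "src I a" i] show ?thesis
    using M by (simp add: sent_on_sends recv_on_rcvs eq)
next
  case False
  have "set (rcvs t) \<subseteq> M" using assms(2) by (force simp: set_rcvs)
  then have "filter (\<lambda>a. dst I a = i) (rcvs t) = []" using False by (auto simp: filter_empty_conv)
  then show ?thesis by simp
qed

end

section \<open>From the three conditions to synchronous reorderings of FIFO traces\<close>

locale good_ring_system = ring_system +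
  assumes good: "set u \<subseteq> M \<Longrightarrow> good I (states u)"
begin

lemma live_send:
  assumes "set u \<subseteq> M" "live I (states u)" "a \<in> M"
    "post (trans I (src I a)) (states u (src I a)) (Snd a) \<noteq> {}"
  shows "live I (states (u @ [a]))"
  using good[OF assms(1)] assms(2-) by (simp add: good_def sync_states_snoc)

lemma live_commute:
  assumes "set u \<subseteq> M" "a \<in> M" "b \<in> M" "src I a \<noteq> src I b"
    "live I (states (u @ [a]))" "live I (states (u @ [b]))"
  shows "live I (states (u @ [a, b]))"
  using good[OF assms(1)] assms(2-) live_appendD[of I u "[a]"]
  by (simp add: good_def sync_states_snoc sync_states_snoc2)

lemma swap_one:
  assumes "set u \<subseteq> M" "a \<in> M" "b \<in> M" "dst I a = src I b" "live I (states (u @ [a]))"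
  shows "posts (trans I (src I b)) (states u (src I b)) [Snd b, Rcv a] \<subseteq> states (u @ [a, b]) (src I b)"
  using good[OF assms(1)] assms(2-) live_appendD[of I u "[a]"]
  by (simp add: good_def sync_states_snoc sync_states_snoc2)

text \<open>Condition (1) is applied once for each send. Exchanging messages sent by
  \<open>i\<close> changes component \<open>i\<close> only by these sends, so the next send of the
  block is still enabled and can be received.\<close>

lemma live_sends:
  assumes "set u \<subseteq> M" "live I (states u)" "set s \<subseteq> M" "\<forall>a\<in>set s. src I a = i"
    "posts (trans I i) (states u i) (map Snd s) \<noteq> {}"
  shows "live I (states (u @ s))"
  using assms(3-)
proof (induction s rule: rev_induct)
  case (snoc a s)
  then have "posts (trans I i) (states u i) (map Snd s) \<noteq> {}" by auto
  then have "live I (states (u @ s))" using snoc by simp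
  moreover have "post (trans I i) (states (u @ s) i) (Snd a) \<noteq> {}"
    using snoc.prems states_sends[of s i u] by simp
  ultimately show ?case using live_send[of "u @ s" a] snoc.prems assms(1) by simp
qed (use assms in simp)

text \<open>Condition (2) carries the exchange of \<open>b\<close> along \<open>s\<close>. It
  applies because the messages of \<open>s\<close> are sent by the destination of \<open>b\<close>,
  which differs from the source of \<open>b\<close>.\<close>

lemma live_sends_receive:
  assumes "set u \<subseteq> M" "set s \<subseteq> M" "b \<in> M" "\<forall>a\<in>set s. src I a = dst I b"
    "live I (states (u @ s))" "live I (states (u @ [b]))"
  shows "live I (states (u @ s @ [b]))"
  using assms(2,4,5)
proof (induction s rule: rev_induct)
  case (snoc a s)
  have "live I (states ((u @ s) @ [a]))" using snoc.prems by simp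
  moreover from this have "live I (states ((u @ s) @ [b]))"
    using snoc live_appendD by simp
  moreover have "src I a \<noteq> src I b" using snoc.prems msg_props(3)[OF assms(3)] by auto
  ultimately show ?case using live_commute[of "u @ s" a b] snoc.prems assms by simp
qed (use assms in simp)

text \<open>Condition (3) moves the reception over the last send, and the induction hypothesis moves
  it over the others. Liveness of \<open>u @ s @ [b]\<close> for the shorter block \<open>s\<close>
  is what allows condition (3) to be used there.\<close>

lemma receive_first:
  assumes "set u \<subseteq> M" "set s \<subseteq> M" "b \<in> M" "dst I b = i" "\<forall>a\<in>set s. src I a = i"
    "live I (states (u @ s))" "live I (states (u @ [b]))"
  shows "posts (trans I i) (states u i) (map Snd s @ [Rcv b]) \<subseteq> posts (trans I i) (states u i) (Rcv b # map Snd s)"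
  using assms(2,5,6)
proof (induction s rule: rev_induct)
  case (snoc a s)
  let ?R = "trans I i"
  have ls: "live I (states (u @ s))" using snoc.prems live_appendD[of I "u @ s" "[a]"] by simp
  then have lb: "live I (states ((u @ s) @ [b]))"
    using live_sends_receive[OF assms(1) _ assms(3)] snoc.prems assms by simp
  have b: "src I b \<noteq> i" using msg_props(3)[OF assms(3)] assms(4) by simp
  have "posts ?R (states u i) (map Snd (s @ [a]) @ [Rcv b]) = posts ?R (states (u @ s) i) [Snd a, Rcv b]"
    using snoc.prems states_sends[of s i u] by simp
  also have "\<dots> \<subseteq> states ((u @ s) @ [b, a]) i"
    using swap_one[of "u @ s" b a] snoc.prems assms lb by simp
  also have "\<dots> = post ?R (posts ?R (states u i) (map Snd s @ [Rcv b])) (Snd a)"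
    using snoc.prems states_sends[of s i u] b assms(4) by (simp add: sync_states_snoc2 sync_step_def del: append_assoc)
  also have "\<dots> \<subseteq> post ?R (posts ?R (states u i) (Rcv b # map Snd s)) (Snd a)"
    using snoc ls by (intro post_mono) simp
  finally show ?case by simp
qed simp

text \<open>A peer that lags behind the synchronous word can catch up by one reception and still
  send \<open>a\<close>. The reception is first performed after all the sends, which is possible by
  \<open>live_sends_receive\<close>, and then moved forward by \<open>receive_first\<close>.\<close>

lemma insert_receive:
  assumes u: "set u \<subseteq> M" "live I (states u)" and a: "a \<in> M" "src I a = i"
    and ne: "post (trans I i) (after I i (partial_word I i n u)) (Snd a) \<noteq> {}"
  shows "post (trans I i) (after I i (partial_word I i (Suc n) u)) (Snd a) \<noteq> {}"
proof (cases "n < length (filter (\<lambda>a. dst I a = i) u)")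
  case False
  then show ?thesis using ne partial_word_full[OF u(1)] by simp
next
  case True
  then obtain u1 b u2 where *: "u = u1 @ b # u2" "dst I b = i"
      "partial_word I i n u = local_word I i (syn u1) @ map Snd (filter (\<lambda>a. src I a = i) u2)"
      "partial_word I i (Suc n) u = local_word I i (syn u1) @ Rcv b # map Snd (filter (\<lambda>a. src I a = i) u2)"
    using partial_word_split[OF u(1)] by blast
  \<comment> \<open>\<open>a\<close> joins the block of sends behind the place of the new reception,
    so that the reception ends up in front of all of them.\<close>
  define s where "s = filter (\<lambda>a. src I a = i) u2 @ [a]"
  let ?R = "trans I i"
  have M: "set u1 \<subseteq> M" "set s \<subseteq> M" "b \<in> M" "\<forall>a\<in>set s. src I a = i"
    using u(1) *(1) a by (auto simp: s_def)
  have l1: "live I (states u1)" "live I (states (u1 @ [b]))"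
    using u(2) live_appendD[of I u1 "b # u2"] live_appendD[of I "u1 @ [b]" "u2"] *(1) by auto
  have "posts ?R (states u1 i) (map Snd s) \<noteq> {}"
    using ne *(3) states_after[OF M(1)] by (simp add: after_append s_def)
  then have l2: "live I (states (u1 @ s))" using live_sends M l1 by blast
  then have "live I (states ((u1 @ s) @ [b]))" using live_sends_receive M l1 *(2) by simp
  then have "states ((u1 @ s) @ [b]) i \<noteq> {}" using msg_props[OF M(3)] *(2) by (auto simp: live_def)
  then have "posts ?R (states u1 i) (map Snd s @ [Rcv b]) \<noteq> {}"
    using msg_props[OF M(3)] *(2) states_sends[of s i u1] M(4) by (simp add: sync_states_snoc sync_step_def del: append_assoc split: if_splits)
  then have "posts ?R (states u1 i) (Rcv b # map Snd s) \<noteq> {}"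
    using receive_first[OF M(1,2,3) *(2) M(4) l2 l1(2)] by blast
  then show ?thesis using *(4) states_after[OF M(1)] by (simp add: after_append s_def)
qed

text \<open>Two facts are kept along the trace: the sends so far can be exchanged synchronously, and
  moving the receptions of a peer to their synchronous places loses none of its states. For a new
  send, \<open>insert_receive\<close> is iterated until the sender has caught up, and condition (1)
  applies; a new reception is put in its place by \<open>receive_first\<close>.\<close>

lemma live_sends_of:
  "\<lbrakk>msg_of ` set t \<subseteq> M; fifo I t; \<forall>i\<in>{1..N}. after I i (local_word I i t) \<noteq> {}\<rbrakk> \<Longrightarrow>
   live I (states (sends t)) \<and>
   (\<forall>i\<in>{1..N}. after I i (local_word I i t) \<subseteq>
      after I i (partial_word I i (length (filter (\<lambda>a. dst I a = i) (rcvs t))) (sends t)))"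
proof (induction t rule: rev_induct)
  case Nil
  then show ?case by (simp add: live_def)
next
  case (snoc x t)
  let ?n = "\<lambda>i. length (filter (\<lambda>a. dst I a = i) (rcvs t))" and ?u = "sends t"
  have t: "msg_of ` set t \<subseteq> M" "fifo I t" using snoc.prems by (auto simp: fifo_snoc)
  have "\<forall>i\<in>{1..N}. after I i (local_word I i t) \<noteq> {}"
  proof
    fix i assume "i \<in> {1..N}"
    then have "after I i (local_word I i (t @ [x])) \<noteq> {}" using snoc.prems by blast
    then show "after I i (local_word I i t) \<noteq> {}" by (auto split: if_splits)
  qed
  then have l: "live I (states ?u)"
    and sub: "\<And>i. i \<in> {1..N} \<Longrightarrow> after I i (local_word I i t) \<subseteq> after I i (partial_word I i (?n i) ?u)"
    using snoc.IH t by auto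
  have u: "set ?u \<subseteq> M" using t(1) by (force simp: set_sends)
  show ?case
  proof (cases x)
    case (Snd a)
    let ?i = "src I a"
    have a: "a \<in> M" using snoc.prems Snd by simp
    have i: "?i \<in> {1..N}" using msg_props[OF a] by simp
    have sub': "after I i (local_word I i (t @ [x])) \<subseteq>
      after I i (partial_word I i (length (filter (\<lambda>a. dst I a = i) (rcvs (t @ [x])))) (sends (t @ [x])))"
      if "i \<in> {1..N}" for i
      using sub[OF that] prefix_length_le[OF fifo_into[OF t(2,1)]] post_mono
      by (simp add: Snd partial_word_snoc[OF u])
    have "after I ?i (local_word I ?i (t @ [x])) \<noteq> {}" using snoc.prems i by blast
    then have "post (trans I ?i) (after I ?i (partial_word I ?i (?n ?i) ?u)) (Snd a) \<noteq> {}"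
      using post_mono[OF sub[OF i], of "trans I ?i" "Snd a"] by (auto simp: Snd)
    then have "post (trans I ?i) (after I ?i (partial_word I ?i (?n ?i + m) ?u)) (Snd a) \<noteq> {}" for m
      by (induction m) (use insert_receive[OF u l a refl] in auto)
    \<comment> \<open>At most \<open>length ?u\<close> messages are addressed to the peer, so with
      this many additional receptions its partial word is the full synchronous one.\<close>
    from this[of "length ?u"] have "post (trans I ?i) (states ?u ?i) (Snd a) \<noteq> {}"
      using partial_word_full[OF u, of ?i "?n ?i + length ?u"] states_after[OF u] by (simp add: trans_le_add2)
    then have "live I (states (sends (t @ [x])))" using live_send[OF u l a] Snd by simp
    then show ?thesis using sub' by blast
  next
    case (Rcv a)
    let ?i = "dst I a" and ?n' = "length (filter (\<lambda>b. dst I b = dst I a) (rcvs t))"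
    have a: "a \<in> M" using snoc.prems Rcv by simp
    have i: "?i \<in> {1..N}" using msg_props[OF a] by simp
    \<comment> \<open>By FIFO, \<open>a\<close> is the first message addressed to this peer that it
      has not yet received. The reception inserted by \<open>partial_word_split\<close> is therefore
      that of \<open>a\<close>.\<close>
    have "prefix (filter (\<lambda>b. dst I b = ?i) (rcvs t) @ [a]) (filter (\<lambda>b. dst I b = ?i) ?u)"
      using fifo_into[OF snoc.prems(2,1), of ?i] Rcv by simp
    then obtain w where w: "filter (\<lambda>b. dst I b = ?i) ?u = filter (\<lambda>b. dst I b = ?i) (rcvs t) @ a # w"
      by (auto simp: prefix_def)
    then have "?n' < length (filter (\<lambda>b. dst I b = ?i) ?u)"
      "filter (\<lambda>b. dst I b = ?i) ?u ! ?n' = a" by simp_all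
    with partial_word_split[OF u this(1)] obtain u1 u2 where *: "?u = u1 @ a # u2"
      "partial_word I ?i ?n' ?u = local_word I ?i (syn u1) @ map Snd (filter (\<lambda>b. src I b = ?i) u2)"
      "partial_word I ?i (Suc ?n') ?u = local_word I ?i (syn u1) @ Rcv a # map Snd (filter (\<lambda>b. src I b = ?i) u2)"
      by auto
    define s where "s = filter (\<lambda>b. src I b = ?i) u2"
    let ?R = "trans I ?i"
    have M: "set u1 \<subseteq> M" "set s \<subseteq> M" "\<forall>b\<in>set s. src I b = ?i"
      using u *(1) by (auto simp: s_def)
    have l1: "live I (states u1)" "live I (states (u1 @ [a]))"
      using l live_appendD[of I u1 "a # u2"] live_appendD[of I "u1 @ [a]" "u2"] *(1) by auto
    have sub_a: "after I ?i (local_word I ?i (t @ [x])) \<subseteq> posts ?R (states u1 ?i) (map Snd s @ [Rcv a])"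
      using post_mono[OF sub[OF i], of ?R "Rcv a"] *(2) states_after[OF M(1)] Rcv
      by (simp add: after_append s_def)
    moreover have "after I ?i (local_word I ?i (t @ [x])) \<noteq> {}" using snoc.prems i by blast
    ultimately have "posts ?R (states u1 ?i) (map Snd s) \<noteq> {}" by auto
    then have l2: "live I (states (u1 @ s))" using live_sends M l1 by blast
    have "after I ?i (local_word I ?i (t @ [x])) \<subseteq> posts ?R (states u1 ?i) (Rcv a # map Snd s)"
      using sub_a receive_first[OF M(1,2) a refl M(3) l2 l1(2)] by blast
    also have "\<dots> = after I ?i (partial_word I ?i (Suc ?n') ?u)"
      using *(3) states_after[OF M(1)] by (simp add: after_append s_def)
    finally have main: "after I ?i (local_word I ?i (t @ [x])) \<subseteq> after I ?i (partial_word I ?i (Suc ?n') ?u)" .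
    have "after I i (local_word I i (t @ [x])) \<subseteq>
      after I i (partial_word I i (length (filter (\<lambda>a. dst I a = i) (rcvs (t @ [x])))) (sends (t @ [x])))"
      if "i \<in> {1..N}" for i
      using sub[OF that] main Rcv by (cases "i = dst I a") auto
    then show ?thesis using l Rcv by simp
  qed
qed

end

section \<open>Synchronizability in oriented rings\<close>

context ring_system
begin

text \<open>Every send is matched by a reception, so all channels are empty and only the free choice
  of a state in each component of D(u) remains.\<close>

lemma reach_syn_iff:
  assumes "set u \<subseteq> M"
  shows "reach I (c0 I) (syn u) c \<longleftrightarrow>
    (\<forall>i\<in>{1..N}. fst c i \<in> states u i) \<and> (\<forall>i. i \<notin> {1..N} \<longrightarrow> fst c i = 0) \<and> stable c"
proof -
  have "msg_of ` set (syn u) \<subseteq> M" using assms by (auto simp: syn_def)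
  moreover have "recv_on I i j (syn u) = sent_on I i j (syn u)" for i j
    by (simp add: recv_on_rcvs sent_on_sends)
  ultimately show ?thesis
    unfolding reach_iff stable_def using fifo_syn[of I u] states_after[OF assms] by auto
qed

lemma reach_acts: "reach I (c0 I) t c \<Longrightarrow> set (sends t) \<subseteq> M"
  unfolding reach_iff by (force simp: set_sends)

lemma reach_exists:
  assumes "msg_of ` set t \<subseteq> M" "fifo I t" "\<And>i. i \<in> {1..N} \<Longrightarrow> f i \<in> after I i (local_word I i t)"
  shows "\<exists>c. reach I (c0 I) t c \<and> (\<forall>i\<in>{1..N}. fst c i = f i)"
proof -
  \<comment> \<open>Each channel contains what was sent on it and not yet received.\<close>
  define c where "c = ((\<lambda>i. if i \<in> {1..N} then f i else 0),
    (\<lambda>i j. drop (length (recv_on I i j t)) (sent_on I i j t)))"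
  have "sent_on I i j t = recv_on I i j t @ snd c i j" for i j
    using fifo_prefixD[OF assms(2), of i j] by (auto simp: c_def prefix_def)
  then have "reach I (c0 I) t c"
    unfolding reach_iff using assms by (auto simp: c_def)
  then show ?thesis by (auto simp: c_def)
qed

lemma live_iff_reach_syn:
  assumes "set u \<subseteq> M" shows "live I (states u) \<longleftrightarrow> (\<exists>c. reach I (c0 I) (syn u) c)"
proof
  assume l: "live I (states u)"
  then have "\<forall>i\<in>{1..N}. (SOME q. q \<in> states u i) \<in> states u i"
    by (auto simp: live_def intro: some_in_eq[THEN iffD2])
  then show "\<exists>c. reach I (c0 I) (syn u) c"
    unfolding reach_syn_iff[OF assms] stable_def
    by (intro exI[of _ "((\<lambda>i. if i \<in> {1..N} then SOME q. q \<in> states u i else 0), \<lambda>i j. [])"]) auto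
qed (auto simp: reach_syn_iff[OF assms] live_def)

lemma T_0_iff: "t \<in> T I 0 \<longleftrightarrow> (\<exists>u. set u \<subseteq> M \<and> t = syn u \<and> live I (states u))"
  unfolding T_def synchronous_iff using live_iff_reach_syn reach_acts by fastforce

lemma T_omega_iff: "t \<in> T_omega I \<longleftrightarrow> (\<exists>c. reach I (c0 I) t c)"
proof
  assume "\<exists>c. reach I (c0 I) t c"
  moreover from this have "bounded_fifo I (Suc (length t)) t"
    using fifo_imp_bounded reach_iff by blast
  ultimately have "t \<in> T I (Suc (length t))" by (simp add: T_def)
  then show "t \<in> T_omega I" unfolding T_omega_def by blast
qed (auto simp: T_omega_def T_def)

text \<open>One inclusion between the two sets is trivial. For the other, a synchronous trace is
  determined by its sends, so \<open>syn (sends t)\<close> is the only candidate to match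
  \<open>t\<close>.\<close>

lemma synchronizable_iff:
  "synchronizable I \<longleftrightarrow> (\<forall>t c. reach I (c0 I) t c \<longrightarrow>
     live I (states (sends t)) \<and> (stable c \<longrightarrow> (\<forall>i\<in>{1..N}. fst c i \<in> states (sends t) i)))"
  (is "_ \<longleftrightarrow> ?R")
proof -
  have sub: "ST_of I (T I 0) \<subseteq> ST_of I (T_omega I)"
    unfolding ST_of_def T_omega_def by blast
  have "synchronizable I \<longleftrightarrow> ST_of I (T_omega I) \<subseteq> ST_of I (T I 0)"
    unfolding synchronizable_def using sub by blast
  also have "\<dots> \<longleftrightarrow> ?R"
  proof
    assume s: "ST_of I (T_omega I) \<subseteq> ST_of I (T I 0)"
    show ?R
    proof (intro allI impI conjI)
      fix t c assume r: "reach I (c0 I) t c"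
      then have t: "t \<in> T_omega I" unfolding T_omega_iff by blast
      then have "Inl (sends t) \<in> ST_of I (T I 0)" using s unfolding ST_of_def by blast
      then show "live I (states (sends t))" unfolding ST_of_def by (auto simp: T_0_iff)
      assume "stable c"
      then have "Inr (sends t, c) \<in> ST_of I (T I 0)" using s t r unfolding ST_of_def by blast
      then obtain u where "set u \<subseteq> M" "sends t = u" "reach I (c0 I) (syn u) c"
        unfolding ST_of_def by (auto simp: T_0_iff)
      then show "\<forall>i\<in>{1..N}. fst c i \<in> states (sends t) i" using reach_syn_iff by blast
    qed
  next
    assume R: ?R
    show "ST_of I (T_omega I) \<subseteq> ST_of I (T I 0)"
    proof
      fix x assume "x \<in> ST_of I (T_omega I)"
      then consider t where "x = Inl (sends t)" "t \<in> T_omega I"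
        | t c where "x = Inr (sends t, c)" "reach I (c0 I) t c" "stable c"
        unfolding ST_of_def by blast
      then show "x \<in> ST_of I (T I 0)"
      proof cases
        case 1
        then have "syn (sends t) \<in> T I 0" unfolding T_0_iff T_omega_iff using R reach_acts by blast
        then have "sends (syn (sends t)) \<in> sends ` T I 0" by (rule imageI)
        then show ?thesis using 1(1) by (simp add: ST_of_def)
      next
        case 2
        then have "syn (sends t) \<in> T I 0" unfolding T_0_iff using R reach_acts by blast
        moreover have "reach I (c0 I) (syn (sends t)) c"
          unfolding reach_syn_iff[OF reach_acts[OF 2(2)]]
          using 2(2,3) R 2(2)[unfolded reach_iff] by blast
        ultimately have "Inr (sends (syn (sends t)), c) \<in> ST_of I (T I 0)"
          using 2(3) unfolding ST_of_def by blast
        then show ?thesis using 2(1) by simp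
      qed
    qed
  qed
  finally show ?thesis .
qed

section \<open>Necessity of the three conditions\<close>

lemma synchronizable_live:
  assumes "synchronizable I" "msg_of ` set t \<subseteq> M" "fifo I t" "\<forall>i\<in>{1..N}. after I i (local_word I i t) \<noteq> {}"
  shows "live I (states (sends t))"
proof -
  have "(SOME q. q \<in> after I i (local_word I i t)) \<in> after I i (local_word I i t)" if "i \<in> {1..N}" for i
    using assms(4) that by (simp add: some_in_eq)
  from reach_exists[OF assms(2,3) this] show ?thesis using assms(1) synchronizable_iff by blast
qed

lemma synchronizable_stable:
  assumes "synchronizable I" "msg_of ` set t \<subseteq> M" "fifo I t" "\<forall>i\<in>{1..N}. after I i (local_word I i t) \<noteq> {}"
    and st: "\<And>i j. sent_on I i j t = recv_on I i j t" and i: "i \<in> {1..N}"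
  shows "after I i (local_word I i t) \<subseteq> states (sends t) i"
proof
  fix q assume q: "q \<in> after I i (local_word I i t)"
  \<comment> \<open>The given state \<open>q\<close> of peer \<open>i\<close> is completed by
    arbitrary states of the other peers, which the independence of the local runs permits.\<close>
  define f where "f j = (if j = i then q else SOME q. q \<in> after I j (local_word I j t))" for j
  have "f j \<in> after I j (local_word I j t)" if "j \<in> {1..N}" for j
    using assms(4) that q by (auto simp: f_def some_in_eq)
  from reach_exists[OF assms(2,3) this] obtain c where c: "reach I (c0 I) t c" "\<forall>i\<in>{1..N}. fst c i = f i"
    by blast
  moreover have "stable c" using c(1) st unfolding reach_iff stable_def by simp
  ultimately have "fst c i \<in> states (sends t) i" using assms(1) synchronizable_iff i by blast
  then show "q \<in> states (sends t) i" using c(2) i by (simp add: f_def)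
qed

text \<open>Each condition results from applying synchronizability to the trace that displays it:
  the first two through the sequence of sends, the third through the stable configurations.\<close>

lemma synchronizable_imp_good:
  assumes s: "synchronizable I" and u: "set u \<subseteq> M"
  shows "good I (states u)"
  unfolding good_def
proof (intro impI conjI ballI)
  assume l: "live I (states u)"
  have Mu: "msg_of ` set (syn u) \<subseteq> M" using u by (auto simp: syn_def)
  fix a assume a: "a \<in> M"
  note aa = msg_props[OF a]
  have au: "after I i (local_word I i (syn u @ [Snd a])) = (if i = src I a then post (trans I i) (states u i) (Snd a) else states u i)" for i
    using states_after[OF u] by simp
  {
    assume "post (trans I (src I a)) (states u (src I a)) (Snd a) \<noteq> {}"
    then have "live I (states (sends (syn u @ [Snd a])))"
      using l au Mu a fifo_syn[of I u] by (intro synchronizable_live[OF s]) (auto simp: live_def)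
    then show "live I (sync_step I (states u) a)" by (simp add: sync_states_snoc)
  }
  fix b assume b: "b \<in> M"
  note bb = msg_props[OF b]
  have pair: "live I (sync_step I (sync_step I (states u) a) b)"
    if ab: "src I a \<noteq> src I b" "live I (sync_step I (states u) a)" "live I (sync_step I (states u) b)"
  proof -
    \<comment> \<open>Both messages are sent before either is received. The sources differ, so each
      send only depends on the sender's component of D(u).\<close>
    let ?t = "(syn u @ [Snd a]) @ [Snd b]"
    have "after I i (local_word I i ?t) \<noteq> {}" if "i \<in> {1..N}" for i
      using l[unfolded live_def, rule_format, OF that] ab(1) ab(2)[unfolded live_def, rule_format, OF that]
        ab(3)[unfolded live_def, rule_format, OF that] states_after[OF u, of i]
      by (cases "i = src I a"; cases "i = src I b") (simp_all add: sync_step_def)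
    moreover have "fifo I ?t" unfolding fifo_snoc_Snd by (rule fifo_syn)
    ultimately have "live I (states (sends ?t))"
      using Mu a b by (intro synchronizable_live[OF s]) auto
    then show ?thesis by (simp add: sync_states_snoc2)
  qed
  then show "live I (sync_step I (sync_step I (states u) a) b)"
    if "src I a \<noteq> src I b" "live I (sync_step I (states u) a)" "live I (sync_step I (states u) b)"
    using that by blast
  {
    assume ab: "dst I a = src I b" "live I (sync_step I (states u) a)"
    let ?i = "src I b"
    \<comment> \<open>The two receptions empty the channels again, so the comparison of stable
      configurations applies.\<close>
    let ?t = "(((syn u @ [Snd a]) @ [Snd b]) @ [Rcv a]) @ [Rcv b]"
    have ne: "src I a \<noteq> src I b" "dst I a \<noteq> dst I b" using aa bb ab same_channel[OF a b] by auto
    show "posts (trans I ?i) (states u ?i) [Snd b, Rcv a] \<subseteq> sync_step I (sync_step I (states u) a) b ?i"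
    proof (cases "posts (trans I ?i) (states u ?i) [Snd b, Rcv a] = {}")
      case False
      have "live I (sync_step I (states u) b)"
      proof -
        have "post (trans I ?i) (states u ?i) (Snd b) \<noteq> {}" using False by auto
        then have "live I (states (sends (syn u @ [Snd b])))"
          using l Mu b fifo_syn[of I u] states_after[OF u] by (intro synchronizable_live[OF s]) (auto simp: live_def)
        then show ?thesis by (simp add: sync_states_snoc)
      qed
      then have l2: "live I (sync_step I (sync_step I (states u) a) b)" using pair ne(1) ab(2) by blast
      \<comment> \<open>Only \<open>?i\<close> deviates from the exchange of \<open>a\<close>
        followed by \<open>b\<close>; every other peer performs the same actions in the same
        order.\<close>
      have eq: "after I i (local_word I i ?t) = (if i = ?i then posts (trans I ?i) (states u ?i) [Snd b, Rcv a]
          else sync_step I (sync_step I (states u) a) b i)" for i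
        using states_after[OF u, of i] aa bb ab ne
        by (auto simp: sync_step_def simp del: append_assoc)
      have f: "fifo I ?t"
        using fifo_syn[of I u] ne unfolding fifo_snoc
        by (auto simp: sent_on_sends recv_on_rcvs same_channel)
      have "after I ?i (local_word I ?i ?t) \<subseteq> states (sends ?t) ?i"
      proof (rule synchronizable_stable[OF s _ f])
        show "\<forall>i\<in>{1..N}. after I i (local_word I i ?t) \<noteq> {}"
          unfolding eq using False l2 by (auto simp: live_def)
      qed (use Mu a b bb in \<open>auto simp: sent_on_sends recv_on_rcvs\<close>)
      then show ?thesis unfolding eq by (simp add: sync_states_snoc2)
    qed simp
  }
qed

section \<open>Sufficiency of the three conditions\<close>

lemma good_imp_synchronizable:
  assumes "\<And>u. set u \<subseteq> M \<Longrightarrow> good I (states u)"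
  shows "synchronizable I"
proof -
  interpret good_ring_system I by unfold_locales (rule assms)
  show ?thesis
    unfolding synchronizable_iff
  proof (intro allI impI)
    fix t c assume r: "reach I (c0 I) t c"
    then have t: "msg_of ` set t \<subseteq> M" "fifo I t" and c: "\<forall>i\<in>{1..N}. fst c i \<in> after I i (local_word I i t)"
      unfolding reach_iff by auto
    from c have "\<forall>i\<in>{1..N}. after I i (local_word I i t) \<noteq> {}" by auto
    note L = live_sends_of[OF t this]
    have "\<forall>i\<in>{1..N}. fst c i \<in> states (sends t) i" if "stable c"
    proof
      fix i assume i: "i \<in> {1..N}"
      have e: "sent_on I j i t = recv_on I j i t" for j
        using r that unfolding reach_iff stable_def by simp
      have Ms: "set (sends t) \<subseteq> M" "set (rcvs t) \<subseteq> M" using t by (force simp: set_sends set_rcvs)+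
      \<comment> \<open>In a stable configuration every message has been received, so the partial
        word of each peer is its full synchronous word.\<close>
      have "length (filter (\<lambda>a. dst I a = i) (sends t)) \<le> length (filter (\<lambda>a. dst I a = i) (rcvs t))"
      proof (cases "\<exists>a\<in>M. dst I a = i")
        case True
        then obtain a where a: "a \<in> M" "dst I a = i" by blast
        have eq: "filter (\<lambda>b. src I b = src I a \<and> dst I b = i) l = filter (\<lambda>b. dst I b = i) l" if "set l \<subseteq> M" for l
          using that a same_channel by (intro filter_cong) auto
        from e[of "src I a"] show ?thesis using Ms by (simp add: sent_on_sends recv_on_rcvs eq)
      next
        case False
        then have "filter (\<lambda>a. dst I a = i) (sends t) = []" using Ms by (auto simp: filter_empty_conv)
        then show ?thesis by simp
      qed
      then show "fst c i \<in> states (sends t) i"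
        using L c i partial_word_full[OF Ms(1)] states_after[OF Ms(1)] by fastforce
    qed
    then show "live I (states (sends t)) \<and> (stable c \<longrightarrow> (\<forall>i\<in>{1..N}. fst c i \<in> states (sends t) i))"
      using L by blast
  qed
qed

lemma synchronizable_iff_good: "synchronizable I \<longleftrightarrow> (\<forall>u. set u \<subseteq> M \<longrightarrow> good I (states u))"
  using synchronizable_imp_good good_imp_synchronizable by blast

end

lemma oriented_ring_imp_ring_system:
  assumes "valid_inst I" "oriented_ring I"
  shows "ring_system I"
proof
  \<comment> \<open>On the range from 1 to N, residues modulo N are distinct: N alone has residue 0,
    and smaller numbers are their own residues.\<close>
  have next_inj: "i = j" if "i \<in> {1..npeers I}" "j \<in> {1..npeers I}" "i mod npeers I = j mod npeers I" for i j
    using that by (cases "i = npeers I"; cases "j = npeers I") auto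
  have ring: "src I a \<in> {1..npeers I} \<and> dst I a = src I a mod npeers I + 1" if "a \<in> msg_set I" for a
    using assms(2) that unfolding oriented_ring_def topology_def by blast
  show "(src I a = src I b) = (dst I a = dst I b)" if "a \<in> msg_set I" "b \<in> msg_set I" for a b
    using ring[OF that(1)] ring[OF that(2)] next_inj by (metis add_right_cancel)
qed (fact assms)

section \<open>Computable functions on encoded data\<close>

lemma rec_Proj0: "rec_eval (Proj 0) (x # xs) x"
  using ev_proj[of 0 "x # xs"] by simp

lemma rec_Proj1: "rec_eval (Proj 1) (x # y # xs) y"
  using ev_proj[of 1 "x # y # xs"] by simp

lemma rec_Proj2: "rec_eval (Proj 2) (x # y # z # xs) z"
  using ev_proj[of 2 "x # y # z # xs"] by simp

lemma rec_Comp1: "rec_eval g xs y \<Longrightarrow> rec_eval f [y] z \<Longrightarrow> rec_eval (Comp f [g]) xs z"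
  by (rule ev_comp[where ys = "[y]"]) auto

lemma rec_Comp2:
  "rec_eval g xs y \<Longrightarrow> rec_eval h xs y' \<Longrightarrow> rec_eval f [y, y'] z \<Longrightarrow> rec_eval (Comp f [g, h]) xs z"
  by (rule ev_comp[where ys = "[y, y']"]) auto

definition "rec_add = PrimRec (Proj 0) (Comp Succ [Proj 0])"
text \<open>The step function of \<open>PrimRec\<close> receives the previous value first and the
  counter second; \<open>Proj 1\<close> is the counter, hence the predecessor.\<close>

definition "rec_decr = PrimRec Zero (Proj 1)"
text \<open>The recursion runs on the first argument, so it is the first argument that is subtracted
  from the second.\<close>

definition "rec_monus = PrimRec (Proj 0) (Comp rec_decr [Proj 0])"
definition "rec_triangle = PrimRec Zero (Comp Succ [Comp rec_add [Proj 0, Proj 1]])"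
definition "rec_pair = Comp rec_add [Comp rec_triangle [rec_add], Proj 0]"

text \<open>On \<open>triangle (a + b) + a\<close>, the Cantor code of \<open>(a, b)\<close>, this search finds the diagonal \<open>a + b\<close>.\<close>
definition "rec_diag = Mu (Comp rec_monus [Comp rec_triangle [Comp Succ [Proj 0]], Comp Succ [Proj 1]])"
definition "rec_fst = Comp rec_monus [Comp rec_triangle [rec_diag], Proj 0]"
definition "rec_snd = Comp rec_monus [rec_fst, rec_diag]"

lemma rec_add: "rec_eval rec_add [n, x] (n + x)"
  unfolding rec_add_def
  by (induction n) (auto intro!: ev_pr0 ev_prS rec_Proj0 rec_Comp1 ev_succ)

lemma rec_decr: "rec_eval rec_decr [n] (n - 1)"
  unfolding rec_decr_def
proof (induction n)
  case (Suc n)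
  show ?case by (rule ev_prS[OF Suc]) (use rec_Proj1 in simp)
qed (auto intro: ev_pr0 ev_zero)

lemma rec_monus: "rec_eval rec_monus [n, x] (x - n)"
  unfolding rec_monus_def
proof (induction n)
  case (Suc n)
  have "rec_eval (Comp rec_decr [Proj 0]) [x - n, n, x] (x - n - 1)"
    by (rule rec_Comp1[OF rec_Proj0 rec_decr])
  then show ?case using ev_prS[OF Suc] by simp
qed (auto intro!: ev_pr0 rec_Proj0)

lemma rec_triangle: "rec_eval rec_triangle [n] (triangle n)"
  unfolding rec_triangle_def
proof (induction n)
  case (Suc n)
  show ?case
    by (rule ev_prS[OF Suc])
      (use rec_Comp1[OF rec_Comp2[OF rec_Proj0 rec_Proj1 rec_add] ev_succ] in simp)
qed (auto intro: ev_pr0 ev_zero)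

lemma rec_pair: "rec_eval rec_pair [a, b] (prod_encode (a, b))"
  unfolding rec_pair_def prod_encode_def
  by (auto intro!: rec_Comp2 rec_Comp1 rec_add rec_triangle rec_Proj0)

lemma triangle_mono: "m \<le> n \<Longrightarrow> triangle m \<le> triangle n"
  by (induction n rule: dec_induct) auto

text \<open>On the code \<open>n\<close> the searched function vanishes as soon as
  \<open>triangle (Suc m)\<close> exceeds \<open>n\<close>. This happens at \<open>a + b\<close> but
  not earlier, since \<open>triangle (a + b)\<close> is at most \<open>n\<close>.\<close>

lemma rec_diag: "rec_eval rec_diag [prod_encode (a, b)] (a + b)"
proof -
  let ?f = "Comp rec_monus [Comp rec_triangle [Comp Succ [Proj 0]], Comp Succ [Proj 1]]"
  let ?n = "prod_encode (a, b)"
  have f: "rec_eval ?f [m, ?n] (Suc ?n - triangle (Suc m))" for m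
    by (rule rec_Comp2 rec_Comp1 rec_monus rec_triangle rec_Proj0 rec_Proj1 ev_succ)+
  have "\<exists>y. rec_eval ?f [m, ?n] (Suc y)" if "m < a + b" for m
  proof -
    have "triangle (Suc m) \<le> triangle (a + b)" using that by (intro triangle_mono) simp
    then have "Suc ?n - triangle (Suc m) = Suc (?n - triangle (Suc m))" by (simp add: prod_encode_def)
    then show ?thesis using f[of m] by auto
  qed
  then show ?thesis
    unfolding rec_diag_def using f[of "a + b"] by (intro ev_mu) (auto simp: prod_encode_def)
qed

lemma rec_fst: "rec_eval rec_fst [prod_encode (a, b)] a"
proof -
  have "rec_eval rec_fst [prod_encode (a, b)] (prod_encode (a, b) - triangle (a + b))"
    unfolding rec_fst_def by (rule rec_Comp2 rec_Comp1 rec_monus rec_triangle rec_diag rec_Proj0)+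
  then show ?thesis by (simp add: prod_encode_def)
qed

lemma rec_snd: "rec_eval rec_snd [prod_encode (a, b)] b"
proof -
  have "rec_eval rec_snd [prod_encode (a, b)] (a + b - a)"
    unfolding rec_snd_def by (rule rec_Comp2 rec_monus rec_diag rec_fst)+
  then show ?thesis by simp
qed

lemma rec_const: "\<exists>r. \<forall>xs. rec_eval r xs k"
proof (induction k)
  case (Suc k)
  then obtain r where "\<forall>xs. rec_eval r xs k" by blast
  then show ?case by (intro exI[of _ "Comp Succ [r]"]) (auto intro: rec_Comp1 ev_succ)
qed (auto intro: ev_zero)

text \<open>Primitive recursion on the value of the condition: zero selects the base case, and the
  step discards the previous value and the counter and evaluates \<open>f\<close> on the original
  argument. The base case is evaluated in any event, so both branches must have values.\<close>

lemma rec_if: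
  assumes "rec_eval c xs n" "rec_eval f xs y" "rec_eval g xs z" "xs = [x]"
  shows "rec_eval (Comp (PrimRec g (Comp f [Proj 2])) [c, Proj 0]) xs (if n = 0 then z else y)"
proof -
  have "rec_eval (PrimRec g (Comp f [Proj 2])) [n, x] (if n = 0 then z else y)"
  proof (induction n)
    case (Suc n)
    show ?case by (rule ev_prS[OF Suc]) (use assms in \<open>simp add: rec_Comp1[OF rec_Proj2]\<close>)
  qed (use assms in \<open>auto intro: ev_pr0\<close>)
  then show ?thesis using assms by (auto intro!: rec_Comp2 rec_Proj0)
qed

section \<open>Encoding data types by natural numbers\<close>

class enc =
  fixes enc :: "'a \<Rightarrow> nat"
  assumes inj_enc: "inj enc"
begin

lemma enc_eq_iff [simp]: "enc x = enc y \<longleftrightarrow> x = y"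
  using inj_enc by (auto dest: injD)

end

text \<open>If every number is a code, then decoding acts as the identity on codes. It is thus
  computable at once, and a search over the numbers is a search over all objects of the
  type.\<close>

class bij_enc = enc +
  assumes surj_enc: "surj enc"
begin

definition dec :: "nat \<Rightarrow> 'a" where
  "dec = inv enc"

lemma enc_dec [simp]: "enc (dec n) = n"
  unfolding dec_def using surj_enc by (simp add: surj_f_inv_f)

lemma dec_enc [simp]: "dec (enc x) = x"
  unfolding dec_def using inj_enc by simp

end

instantiation nat :: bij_enc
begin
definition "enc_nat = (id :: nat \<Rightarrow> nat)"
instance by standard (simp_all add: enc_nat_def)
end

instantiation bool :: enc
begin
definition "enc_bool = (of_bool :: bool \<Rightarrow> nat)"
instance by standard (auto simp: enc_bool_def inj_def)
end

text \<open>The code agrees with the one inside \<open>enc_inst\<close>, so the parts of an encoded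
  instance can be read with \<open>dec\<close>.\<close>

instantiation act :: bij_enc
begin
definition enc_act_eq: "enc x = Defs.enc_act x"
instance
proof
  show "inj (enc :: act \<Rightarrow> nat)"
  proof (rule injI)
    fix x y :: act
    show "enc x = enc y \<Longrightarrow> x = y"
      by (cases x; cases y; simp add: enc_act_eq) presburger+
  qed
  show "surj (enc :: act \<Rightarrow> nat)"
  proof (rule surjI)
    fix n :: nat
    show "enc (if even n then Snd (n div 2) else Rcv (n div 2)) = n"
      by (simp add: enc_act_eq)
  qed
qed
end

instantiation prod :: (enc, enc) enc
begin
definition enc_prod_def: "enc p = prod_encode (map_prod enc enc p)"
instance
proof
  show "inj (enc :: 'a \<times> 'b \<Rightarrow> nat)"
    by (rule injI) (auto simp: enc_prod_def)
qed
end

instance prod :: (bij_enc, bij_enc) bij_enc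
proof
  show "surj (enc :: 'a \<times> 'b \<Rightarrow> nat)"
  proof (rule surjI)
    fix n :: nat
    show "enc (map_prod dec dec (prod_decode n) :: 'a \<times> 'b) = n"
      by (simp add: enc_prod_def prod.map_comp o_def map_prod_def split_beta)
  qed
qed

instantiation list :: (enc) enc
begin
definition enc_list_def: "enc l = list_encode (map enc l)"
instance
proof
  show "inj (enc :: 'a list \<Rightarrow> nat)"
    by (rule injI) (simp add: enc_list_def inj_eq[OF inj_list_encode] inj_map_eq_map[OF inj_enc])
qed
end

instance list :: (bij_enc) bij_enc
proof
  show "surj (enc :: 'a list \<Rightarrow> nat)"
  proof (rule surjI)
    fix n :: nat
    show "enc (map dec (list_decode n) :: 'a list) = n"
      by (simp add: enc_list_def o_def)
  qed
qed

lemma enc_Pair: "enc (a, b) = prod_encode (enc a, enc b)"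
  by (simp add: enc_prod_def)

lemma enc_Nil: "enc [] = 0"
  by (simp add: enc_list_def)

lemma enc_Cons: "enc (a # l) = Suc (enc (a, l))"
  by (simp add: enc_list_def enc_Pair)

text \<open>The code of a list can serve as an iteration count that suffices to traverse the
  list.\<close>

lemma length_le_enc: "length l \<le> enc l"
proof (induction l)
  case (Cons a l)
  then show ?case
    using le_prod_encode_2[of "enc l" "enc a"] by (simp add: enc_Cons enc_Pair)
qed simp

section \<open>Closure properties of computable functions\<close>

definition computable :: "('a :: enc \<Rightarrow> 'b :: enc) \<Rightarrow> bool" where
  "computable f \<longleftrightarrow> (\<exists>r. \<forall>x. rec_eval r [enc x] (enc (f x)))"

lemma computableI: "(\<And>x. rec_eval r [enc x] (enc (f x))) \<Longrightarrow> computable f"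
  unfolding computable_def by blast

lemma computableE:
  assumes "computable f" obtains r where "\<And>x. rec_eval r [enc x] (enc (f x))"
  using assms unfolding computable_def by blast

text \<open>Computability depends on codes alone, so the result type may change. This is how
  \<open>enc\<close>, \<open>dec\<close> and the truth-valued operations are obtained.\<close>

lemma computable_cong_enc: "\<lbrakk>computable f; \<And>x. enc (g x) = enc (f x)\<rbrakk> \<Longrightarrow> computable g"
  by (simp add: computable_def)

named_theorems computable_intros

lemma computable_const [computable_intros]: "computable (\<lambda>x. k)"
  using rec_const[of "enc k"] by (auto simp: computable_def)

lemma computable_id [computable_intros]: "computable (\<lambda>x. x)"
  by (rule computableI[of "Proj 0"]) (rule rec_Proj0)

lemma computable_compose: "\<lbrakk>computable f; computable g\<rbrakk> \<Longrightarrow> computable (\<lambda>x. f (g x))"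
proof -
  assume "computable f" "computable g"
  then obtain rf rg where "\<And>x. rec_eval rg [enc x] (enc (g x))" "\<And>x. rec_eval rf [enc x] (enc (f x))"
    by (elim computableE) blast
  from rec_Comp1[OF this] show "computable (\<lambda>x. f (g x))" by (rule computableI)
qed

lemma computable_rec1:
  assumes "computable f" "\<And>x. rec_eval r [enc (f x)] (enc (h x))"
  shows "computable h"
proof -
  obtain rf where "\<And>x. rec_eval rf [enc x] (enc (f x))"
    using assms(1) by (elim computableE) blast
  from rec_Comp1[OF this assms(2)] show ?thesis by (rule computableI)
qed

lemma computable_rec2:
  assumes "computable f" "computable g" "\<And>x. rec_eval r [enc (f x), enc (g x)] (enc (h x))"
  shows "computable h"
proof -
  obtain rf rg where "\<And>x. rec_eval rf [enc x] (enc (f x))" "\<And>x. rec_eval rg [enc x] (enc (g x))"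
    using assms(1,2) by (elim computableE) blast
  from rec_Comp2[OF this assms(3)] show ?thesis by (rule computableI)
qed

lemma computable_Pair [computable_intros]:
  "\<lbrakk>computable f; computable g\<rbrakk> \<Longrightarrow> computable (\<lambda>x. (f x, g x))"
  by (erule (1) computable_rec2[where r = rec_pair]) (simp add: enc_Pair rec_pair)

lemma computable_fst [computable_intros]:
  fixes f :: "'a :: enc \<Rightarrow> 'b :: enc \<times> 'c :: enc"
  assumes "computable f" shows "computable (\<lambda>x. fst (f x))"
proof -
  have "computable (fst :: 'b \<times> 'c \<Rightarrow> 'b)"
    by (rule computableI[of rec_fst]) (auto simp: enc_Pair rec_fst)
  then show ?thesis using computable_compose assms by blast
qed

lemma computable_snd [computable_intros]:
  fixes f :: "'a :: enc \<Rightarrow> 'b :: enc \<times> 'c :: enc"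
  assumes "computable f" shows "computable (\<lambda>x. snd (f x))"
proof -
  have "computable (snd :: 'b \<times> 'c \<Rightarrow> 'c)"
    by (rule computableI[of rec_snd]) (auto simp: enc_Pair rec_snd)
  then show ?thesis using computable_compose assms by blast
qed

lemma computable_if [computable_intros]:
  assumes "computable c" "computable f" "computable g"
  shows "computable (\<lambda>x. if c x then f x else g x)"
proof -
  obtain rc rf rg where r: "\<And>x. rec_eval rc [enc x] (enc (c x))" "\<And>x. rec_eval rf [enc x] (enc (f x))"
    "\<And>x. rec_eval rg [enc x] (enc (g x))"
    using assms by (elim computableE) blast
  show ?thesis
  proof (rule computableI)
    fix x
    have eq: "enc (if c x then f x else g x) = (if enc (c x) = 0 then enc (g x) else enc (f x))"
      by (simp add: enc_bool_def)
    show "rec_eval (Comp (PrimRec rg (Comp rf [Proj 2])) [rc, Proj 0]) [enc x] (enc (if c x then f x else g x))"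
      unfolding eq by (rule rec_if[OF r refl])
  qed
qed

lemma computable_conj [computable_intros]:
  "\<lbrakk>computable P; computable Q\<rbrakk> \<Longrightarrow> computable (\<lambda>x. P x \<and> Q x)"
  by (rule computable_cong_enc[OF computable_if[of P Q "\<lambda>_. False"]]) (auto intro: computable_const)

lemma computable_not [computable_intros]: "computable P \<Longrightarrow> computable (\<lambda>x. \<not> P x)"
  by (rule computable_cong_enc[OF computable_if[of P "\<lambda>_. False" "\<lambda>_. True"]]) (auto intro: computable_const)

lemma computable_disj [computable_intros]:
  "\<lbrakk>computable P; computable Q\<rbrakk> \<Longrightarrow> computable (\<lambda>x. P x \<or> Q x)"
  by (rule computable_cong_enc[OF computable_if[of P "\<lambda>_. True" Q]]) (auto intro: computable_const)

lemma computable_imp [computable_intros]: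
  "\<lbrakk>computable P; computable Q\<rbrakk> \<Longrightarrow> computable (\<lambda>x. P x \<longrightarrow> Q x)"
  by (rule computable_cong_enc[OF computable_if[of P Q "\<lambda>_. True"]]) (auto intro: computable_const)

lemma computable_Suc [computable_intros]: "computable f \<Longrightarrow> computable (\<lambda>x. Suc (f x))"
  by (erule computable_rec1[where r = Succ]) (simp add: enc_nat_def ev_succ)

lemma computable_add [computable_intros]:
  fixes f g :: "_ \<Rightarrow> nat"
  shows "\<lbrakk>computable f; computable g\<rbrakk> \<Longrightarrow> computable (\<lambda>x. f x + g x)"
  by (erule (1) computable_rec2[where r = rec_add]) (simp add: enc_nat_def rec_add)

lemma computable_monus [computable_intros]:
  fixes f g :: "_ \<Rightarrow> nat"
  shows "\<lbrakk>computable f; computable g\<rbrakk> \<Longrightarrow> computable (\<lambda>x. f x - g x)"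
  by (rule computable_rec2[of g f rec_monus]) (simp_all add: enc_nat_def rec_monus)

lemma computable_enc [computable_intros]: "computable f \<Longrightarrow> computable (\<lambda>x. enc (f x))"
  by (erule computable_cong_enc) (simp add: enc_nat_def)

lemma computable_dec [computable_intros]:
  fixes f :: "_ \<Rightarrow> nat"
  shows "computable f \<Longrightarrow> computable (\<lambda>x. dec (f x))"
  by (erule computable_cong_enc) (simp add: enc_nat_def)

text \<open>Codes are injective, and two numbers agree iff both truncated differences
  vanish.\<close>

lemma computable_eq [computable_intros]:
  assumes "computable f" "computable g" shows "computable (\<lambda>x. f x = g x)"
proof (rule computable_cong_enc)
  show "computable (\<lambda>x. 1 - ((enc (f x) - enc (g x)) + (enc (g x) - enc (f x))))"
    by (intro computable_intros assms)
  show "enc (f x = g x) = enc (1 - ((enc (f x) - enc (g x)) + (enc (g x) - enc (f x))))" for x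
  proof (cases "f x = g x")
    case False
    then have "enc (f x) \<noteq> enc (g x)" by simp
    then have "1 - ((enc (f x) - enc (g x)) + (enc (g x) - enc (f x))) = 0" by linarith
    then show ?thesis using False by (simp add: enc_bool_def enc_nat_def)
  qed (simp add: enc_bool_def enc_nat_def)
qed

lemma computable_Snd [computable_intros]: "computable f \<Longrightarrow> computable (\<lambda>x. Snd (f x))"
  by (rule computable_cong_enc[OF computable_add[of f f]]) (auto simp: enc_act_eq enc_nat_def)

lemma computable_Rcv [computable_intros]: "computable f \<Longrightarrow> computable (\<lambda>x. Rcv (f x))"
  by (rule computable_cong_enc[OF computable_Suc[OF computable_add[of f f]]]) (auto simp: enc_act_eq enc_nat_def)

lemma computable_Cons [computable_intros]:
  "\<lbrakk>computable f; computable g\<rbrakk> \<Longrightarrow> computable (\<lambda>x. f x # g x)"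
  by (rule computable_cong_enc[OF computable_Suc[OF computable_enc[OF computable_Pair[of f g]]]])
    (auto simp: enc_Cons enc_nat_def)

lemma rec_eval_fst: "rec_eval rec_fst [n] (fst (prod_decode n))"
  using rec_fst[of "fst (prod_decode n)" "snd (prod_decode n)"] by simp

lemma rec_eval_snd: "rec_eval rec_snd [n] (snd (prod_decode n))"
  using rec_snd[of "fst (prod_decode n)" "snd (prod_decode n)"] by simp

lemma computable_hd [computable_intros]:
  fixes f :: "'a :: enc \<Rightarrow> 'b :: enc list"
  assumes "computable f" shows "computable (\<lambda>x. hd (f x))"
proof -
  \<comment> \<open>\<open>hd []\<close> is unspecified but fixed, so its code is a
    constant.\<close>
  obtain r where r: "\<And>xs. rec_eval r xs (enc (hd ([] :: 'b list)))" using rec_const by blast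
  have "computable (hd :: 'b list \<Rightarrow> 'b)"
  proof (rule computableI)
    fix l :: "'b list"
    have eq: "enc (hd l) = (if enc l = 0 then enc (hd ([] :: 'b list)) else fst (prod_decode (enc l - 1)))"
      by (cases l) (simp_all add: enc_Nil enc_Cons enc_Pair)
    show "rec_eval (Comp (PrimRec r (Comp (Comp rec_fst [rec_decr]) [Proj 2])) [Proj 0, Proj 0]) [enc l] (enc (hd l))"
      unfolding eq by (rule rec_if[OF rec_Proj0 rec_Comp1[OF rec_decr rec_eval_fst] r refl])
  qed
  then show ?thesis using computable_compose assms by blast
qed

lemma computable_tl [computable_intros]:
  fixes f :: "'a :: enc \<Rightarrow> 'b :: enc list"
  assumes "computable f" shows "computable (\<lambda>x. tl (f x))"
proof -
  obtain r where r: "\<And>xs. rec_eval r xs 0" using rec_const by blast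
  have "computable (tl :: 'b list \<Rightarrow> 'b list)"
  proof (rule computableI)
    fix l :: "'b list"
    have eq: "enc (tl l) = (if enc l = 0 then 0 else snd (prod_decode (enc l - 1)))"
      by (cases l) (simp_all add: enc_Nil enc_Cons enc_Pair)
    show "rec_eval (Comp (PrimRec r (Comp (Comp rec_snd [rec_decr]) [Proj 2])) [Proj 0, Proj 0]) [enc l] (enc (tl l))"
      unfolding eq by (rule rec_if[OF rec_Proj0 rec_Comp1[OF rec_decr rec_eval_snd] r refl])
  qed
  then show ?thesis using computable_compose assms by blast
qed

lemma computable_funpow [computable_intros]:
  fixes f :: "'a :: enc \<Rightarrow> 'b :: enc \<Rightarrow> 'b"
  assumes "computable (\<lambda>p. f (fst p) (snd p))" "computable n" "computable g"
  shows "computable (\<lambda>x. (f x ^^ n x) (g x))"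
proof -
  obtain rf rn rg where r: "\<And>p. rec_eval rf [enc p] (enc (f (fst p) (snd p)))"
    "\<And>x. rec_eval rn [enc x] (enc (n x))" "\<And>x. rec_eval rg [enc x] (enc (g x))"
    using assms by (elim computableE) blast
  have *: "rec_eval (PrimRec rg (Comp rf [Comp rec_pair [Proj 2, Proj 0]])) [k, enc x] (enc ((f x ^^ k) (g x)))" for k x
  proof (induction k)
    case (Suc k)
    have "rec_eval (Comp rf [Comp rec_pair [Proj 2, Proj 0]]) [enc ((f x ^^ k) (g x)), k, enc x]
        (enc (f x ((f x ^^ k) (g x))))"
      using r(1)[of "(x, (f x ^^ k) (g x))"]
      by (intro rec_Comp1[OF rec_Comp2[OF rec_Proj2 rec_Proj0 rec_pair]]) (simp add: enc_Pair)
    then show ?case using ev_prS[OF Suc] by simp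
  qed (use r in \<open>auto intro: ev_pr0\<close>)
  show ?thesis
    by (rule computableI, rule rec_Comp2[OF r(2) rec_Proj0], unfold enc_nat_def id_apply, rule *)
qed

text \<open>The fold is an iteration on pairs of an accumulator and the rest of the list. The pair
  no longer changes once the rest is empty, so any count not below the length gives the result, in
  particular the code of the list.\<close>

lemma computable_foldl [computable_intros]:
  fixes f :: "'a :: enc \<Rightarrow> 'b :: enc \<Rightarrow> 'c :: enc \<Rightarrow> 'b"
  assumes "computable (\<lambda>p. f (fst p) (fst (snd p)) (snd (snd p)))" "computable a" "computable l"
  shows "computable (\<lambda>x. foldl (f x) (a x) (l x))"
proof -
  define g where "g x p = (if snd p = [] then p else (f x (fst p) (hd (snd p)), tl (snd p)))" for x p
  have *: "(g x ^^ n) (s, k) = (foldl (f x) s k, [])" if "length k \<le> n" for x n s k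
    using that
  proof (induction n arbitrary: s k)
    case (Suc n)
    then show ?case
      by (cases k) (simp_all add: g_def funpow_Suc_right del: funpow.simps)
  qed simp
  have "computable (\<lambda>p. f (fst p) (fst (snd p)) (hd (snd (snd p))))"
    using computable_compose[OF assms(1), of "\<lambda>p. (fst p, fst (snd p), hd (snd (snd p)))"]
    by (simp add: computable_intros)
  then have "computable (\<lambda>p. g (fst p) (snd p))"
    unfolding g_def by (intro computable_intros)
  then have "computable (\<lambda>x. fst ((g x ^^ enc (l x)) (a x, l x)))"
    by (intro computable_intros assms)
  then show ?thesis by (simp add: * length_le_enc)
qed

lemma computable_Bex [computable_intros]:
  assumes "computable (\<lambda>p. P (fst p) (snd p))" "computable l"
  shows "computable (\<lambda>x. \<exists>y\<in>set (l x). P x y)"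
proof -
  have *: "foldl (\<lambda>s y. s \<or> P x y) s k \<longleftrightarrow> s \<or> (\<exists>y\<in>set k. P x y)" for x s k
    by (induction k arbitrary: s) auto
  have "computable (\<lambda>p. P (fst p) (snd (snd p)))"
    using computable_compose[OF assms(1), of "\<lambda>p. (fst p, snd (snd p))"] by (simp add: computable_intros)
  then have "computable (\<lambda>x. foldl (\<lambda>s y. s \<or> P x y) False (l x))"
    by (intro computable_intros assms)
  then show ?thesis by (simp add: *)
qed

lemma computable_Ball [computable_intros]:
  assumes "computable (\<lambda>p. P (fst p) (snd p))" "computable l"
  shows "computable (\<lambda>x. \<forall>y\<in>set (l x). P x y)"
  using computable_not[OF computable_Bex[OF computable_not[OF assms(1)] assms(2)]] by simp

lemma computable_member [computable_intros]:
  assumes "computable f" "computable l"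
  shows "computable (\<lambda>x. f x \<in> set (l x))"
proof -
  have "computable (\<lambda>p. f (fst p))"
    by (rule computable_compose[OF assms(1)]) (intro computable_intros)
  then have "computable (\<lambda>p. f (fst p) = snd p)"
    by (rule computable_eq) (intro computable_intros)
  then have "computable (\<lambda>x. \<exists>y\<in>set (l x). f x = y)"
    by (rule computable_Bex) (rule assms)
  then show ?thesis by simp
qed

lemma computable_foldr [computable_intros]:
  fixes f :: "'a :: enc \<Rightarrow> 'c :: enc \<Rightarrow> 'b :: enc \<Rightarrow> 'b"
  assumes "computable (\<lambda>p. f (fst p) (fst (snd p)) (snd (snd p)))" "computable l" "computable a"
  shows "computable (\<lambda>x. foldr (f x) (l x) (a x))"
proof -
  have rev: "foldl (\<lambda>s y. y # s) s k = rev k @ s" for s k :: "'c list"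
    by (induction k arbitrary: s) auto
  have "computable (\<lambda>p. f (fst p) (snd (snd p)) (fst (snd p)))"
    using computable_compose[OF assms(1), of "\<lambda>p. (fst p, snd (snd p), fst (snd p))"] by (simp add: computable_intros)
  then have "computable (\<lambda>x. foldl (\<lambda>s y. f x y s) (a x) (foldl (\<lambda>s y. y # s) [] (l x)))"
    by (intro computable_intros assms)
  then show ?thesis by (simp add: rev foldr_conv_foldl)
qed

lemma computable_append [computable_intros]:
  assumes "computable f" "computable g" shows "computable (\<lambda>x. f x @ g x)"
proof -
  have "computable (\<lambda>x. foldr (\<lambda>y s. y # s) (f x) (g x))"
    by (rule computable_foldr[OF _ assms]) (intro computable_intros)
  moreover have "foldr (\<lambda>y s. y # s) k k' = k @ k'" for k k' :: "'b list" by (induction k) auto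
  ultimately show ?thesis by simp
qed

lemma computable_map [computable_intros]:
  assumes "computable (\<lambda>p. f (fst p) (snd p))" "computable l"
  shows "computable (\<lambda>x. map (f x) (l x))"
proof -
  have "computable (\<lambda>p. f (fst p) (fst (snd p)))"
    using computable_compose[OF assms(1), of "\<lambda>p. (fst p, fst (snd p))"] by (simp add: computable_intros)
  then have "computable (\<lambda>x. foldr (\<lambda>y s. f x y # s) (l x) [])" by (intro computable_intros assms)
  moreover have "foldr (\<lambda>y s. f x y # s) k [] = map (f x) k" for x k by (induction k) auto
  ultimately show ?thesis by simp
qed

lemma computable_filter [computable_intros]:
  assumes "computable (\<lambda>p. P (fst p) (snd p))" "computable l"
  shows "computable (\<lambda>x. filter (P x) (l x))"
proof -
  have "computable (\<lambda>p. P (fst p) (fst (snd p)))"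
    using computable_compose[OF assms(1), of "\<lambda>p. (fst p, fst (snd p))"] by (simp add: computable_intros)
  then have "computable (\<lambda>x. foldr (\<lambda>y s. if P x y then y # s else s) (l x) [])"
    by (intro computable_intros assms)
  moreover have "foldr (\<lambda>y s. if P x y then y # s else s) k [] = filter (P x) k" for x k
    by (induction k) auto
  ultimately show ?thesis by simp
qed

lemma computable_concat [computable_intros]:
  assumes "computable l" shows "computable (\<lambda>x. concat (l x))"
proof -
  have "computable (\<lambda>x. foldr (\<lambda>y s. y @ s) (l x) [])" by (intro computable_intros assms)
  moreover have "foldr (\<lambda>y s. y @ s) k [] = concat k" for k :: "'b list list" by (induction k) auto
  ultimately show ?thesis by simp
qed

text \<open>Post's theorem: a set is decidable if it and its complement are semidecidable. The
  search stops at the least \<open>n\<close> that satisfies one of the predicates, and since only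
  one of them has witnesses at all, the value of \<open>P x n\<close> there is the answer.\<close>

lemma computable_search:
  fixes P Q :: "'a :: enc \<Rightarrow> nat \<Rightarrow> bool"
  assumes "computable (\<lambda>p. P (fst p) (snd p))" "computable (\<lambda>p. Q (fst p) (snd p))"
  shows "\<exists>r. \<forall>x. (\<exists>n. P x n) \<noteq> (\<exists>n. Q x n) \<longrightarrow> rec_eval r [enc x] (if \<exists>n. P x n then 1 else 0)"
proof -
  have "computable (\<lambda>p. \<not> (P (fst p) (snd p) \<or> Q (fst p) (snd p)))"
    by (intro computable_intros assms)
  then obtain rp rs where rp: "\<And>p. rec_eval rp [enc p] (enc (P (fst p) (snd p)))"
    and rs: "\<And>p. rec_eval rs [enc p] (enc (\<not> (P (fst p) (snd p) \<or> Q (fst p) (snd p))))"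
    using assms(1) by (elim computableE) blast
  \<comment> \<open>\<open>Mu\<close> puts the search variable first and stops at the value 0; hence
    the exchanged projections and the negation in \<open>rs\<close>.\<close>
  let ?s = "Comp rs [Comp rec_pair [Proj 1, Proj 0]]"
  have s: "rec_eval ?s [n, enc x] (of_bool (\<not> (P x n \<or> Q x n)))" for n x
    using rs[of "(x, n)"]
    by (intro rec_Comp1[OF rec_Comp2[OF rec_Proj1 rec_Proj0 rec_pair]]) (simp add: enc_Pair enc_nat_def enc_bool_def)
  have "rec_eval (Comp rp [Comp rec_pair [Proj 0, Mu ?s]]) [enc x] (if \<exists>n. P x n then 1 else 0)"
    if x: "(\<exists>n. P x n) \<noteq> (\<exists>n. Q x n)" for x
  proof -
    define n where "n = (LEAST n. P x n \<or> Q x n)"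
    have n: "P x n \<or> Q x n" unfolding n_def by (rule LeastI_ex) (use x in blast)
    have "rec_eval (Mu ?s) [enc x] n"
    proof (rule ev_mu)
      show "rec_eval ?s [n, enc x] 0" using s[of n x] n by simp
      show "\<forall>m<n. \<exists>y. rec_eval ?s [m, enc x] (Suc y)"
      proof (intro allI impI)
        fix m assume "m < n"
        then have "\<not> (P x m \<or> Q x m)" unfolding n_def by (rule not_less_Least)
        then show "\<exists>y. rec_eval ?s [m, enc x] (Suc y)" using s[of m x] by (intro exI[of _ 0]) simp
      qed
    qed
    then have "rec_eval (Comp rp [Comp rec_pair [Proj 0, Mu ?s]]) [enc x] (enc (P x n))"
      using rp[of "(x, n)"] rec_Comp1[OF rec_Comp2[OF rec_Proj0 _ rec_pair]]
      by (simp add: enc_Pair enc_nat_def)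
    moreover have "P x n \<longleftrightarrow> (\<exists>n. P x n)" using n x by blast
    then have "enc (P x n) = (if \<exists>n. P x n then 1 else 0)" by (simp add: enc_bool_def)
    ultimately show ?thesis by (simp only:)
  qed
  then show ?thesis by blast
qed

section \<open>The decision procedure\<close>

type_synonym system = "nat \<times> (nat \<times> nat \<times> nat) list \<times> (nat \<times> (nat \<times> act \<times> nat) list) list"

definition dec_msg :: "nat \<Rightarrow> nat \<times> nat \<times> nat" where
  "dec_msg m = (hd (dec m), hd (tl (dec m)), hd (tl (tl (dec m))))"

definition dec_trans :: "nat \<Rightarrow> nat \<times> act \<times> nat" where
  "dec_trans t = (hd (dec t), dec (hd (tl (dec t))), hd (tl (tl (dec t))))"

definition dec_peer :: "nat \<Rightarrow> nat \<times> (nat \<times> act \<times> nat) list" where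
  "dec_peer p = (hd (dec p), map dec_trans (dec (hd (tl (dec p)))))"

definition dec_system :: "nat \<Rightarrow> system" where
  "dec_system n = (hd (dec n), map dec_msg (dec (hd (tl (dec n)))), map dec_peer (dec (hd (tl (tl (dec n))))))"

lemma dec_list_encode [simp]: "dec (list_encode l) = l"
  using dec_enc[of l] by (simp add: enc_list_def enc_nat_def)

lemma dec_enc_act [simp]: "dec (enc_act x) = x"
  using dec_enc[of x] by (simp add: enc_act_eq)

lemma dec_system_enc_inst: "dec_system (enc_inst I) = (npeers I, msgs I, peers I)"
  by (auto simp: dec_system_def enc_inst_def dec_msg_def dec_peer_def dec_trans_def
      simp del: list_encode.simps intro!: map_idI)

text \<open>Indexing is written with iterated \<open>tl\<close>, for which the closure rules exist;
  peer \<open>i\<close> is stored at index \<open>i - 1\<close>.\<close>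

definition peer_of :: "system \<Rightarrow> nat \<Rightarrow> nat \<times> (nat \<times> act \<times> nat) list" where
  "peer_of J i = hd ((tl ^^ (i - 1)) (snd (snd J)))"

definition trans_of :: "system \<Rightarrow> nat \<Rightarrow> (nat \<times> act \<times> nat) list" where
  "trans_of J i = snd (peer_of J i)"

text \<open>The numbers from 1 to \<open>fst J\<close>, obtained by an iteration that counts down
  and prepends.\<close>

definition peer_list :: "system \<Rightarrow> nat list" where
  "peer_list J = snd (((\<lambda>p. (fst p - 1, fst p # snd p)) ^^ fst J) (fst J, []))"

definition initial :: "system \<Rightarrow> (nat \<times> nat) list" where
  "initial J = map (\<lambda>i. (i, fst (peer_of J i))) (peer_list J)"

definition all_states :: "system \<Rightarrow> (nat \<times> nat) list" where
  "all_states J = initial J @ concat (map (\<lambda>i. map (\<lambda>t. (i, snd (snd t))) (trans_of J i)) (peer_list J))"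

text \<open>Families are represented by lists of pairs of a peer and a state. Filtering one fixed
  list bounds the length and the entries of every result, so only finitely many lists can
  occur.\<close>

definition next_states :: "system \<Rightarrow> (nat \<times> nat) list \<Rightarrow> nat \<times> nat \<times> nat \<Rightarrow> (nat \<times> nat) list" where
  "next_states J D m = filter (\<lambda>e.
     if fst e = fst (snd m) then \<exists>d\<in>set D. fst d = fst e \<and> (snd d, Snd (fst m), snd e) \<in> set (trans_of J (fst e))
     else if fst e = snd (snd m) then \<exists>d\<in>set D. fst d = fst e \<and> (snd d, Rcv (fst m), snd e) \<in> set (trans_of J (fst e))
     else e \<in> set D) (all_states J)"

definition live_list :: "system \<Rightarrow> (nat \<times> nat) list \<Rightarrow> bool" where
  "live_list J D \<longleftrightarrow> (\<forall>i\<in>set (peer_list J). \<exists>d\<in>set D. fst d = i)"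

definition good_list :: "system \<Rightarrow> (nat \<times> nat) list \<Rightarrow> bool" where
  "good_list J D \<longleftrightarrow> (live_list J D \<longrightarrow>
     (\<forall>a\<in>set (fst (snd J)).
        (\<exists>d\<in>set D. fst d = fst (snd a) \<and> (\<exists>t\<in>set (trans_of J (fst (snd a))). fst t = snd d \<and> fst (snd t) = Snd (fst a)))
        \<longrightarrow> live_list J (next_states J D a)) \<and>
     (\<forall>a\<in>set (fst (snd J)). \<forall>b\<in>set (fst (snd J)). fst (snd a) \<noteq> fst (snd b) \<longrightarrow>
        live_list J (next_states J D a) \<longrightarrow> live_list J (next_states J D b) \<longrightarrow>
        live_list J (next_states J (next_states J D a) b)) \<and>
     (\<forall>a\<in>set (fst (snd J)). \<forall>b\<in>set (fst (snd J)). snd (snd a) = fst (snd b) \<longrightarrow>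
        live_list J (next_states J D a) \<longrightarrow>
        (\<forall>t\<in>set (trans_of J (fst (snd b))). \<forall>t'\<in>set (trans_of J (fst (snd b))).
           (fst (snd b), fst t) \<in> set D \<and> fst (snd t) = Snd (fst b) \<and> fst t' = snd (snd t) \<and> fst (snd t') = Rcv (fst a)
           \<longrightarrow> (fst (snd b), snd (snd t')) \<in> set (next_states J (next_states J D a) b))))"

text \<open>The certificate for the positive answer; \<open>refutation\<close> is the one for the
  negative answer.\<close>

definition invariant :: "system \<Rightarrow> (nat \<times> nat) list list \<Rightarrow> bool" where
  "invariant J X \<longleftrightarrow> initial J \<in> set X \<and>
     (\<forall>D\<in>set X. good_list J D \<and> (\<forall>a\<in>set (fst (snd J)). next_states J D a \<in> set X))"

definition refutation :: "system \<Rightarrow> (nat \<times> nat \<times> nat) list \<Rightarrow> bool" where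
  "refutation J u \<longleftrightarrow> (\<forall>a\<in>set u. a \<in> set (fst (snd J))) \<and> \<not> good_list J (foldl (next_states J) (initial J) u)"

section \<open>Computability of the certificate checks\<close>

lemma computable_dec_system: "computable dec_system"
  unfolding dec_system_def dec_msg_def dec_peer_def dec_trans_def by (intro computable_intros)

lemma computable_peer_of [computable_intros]:
  "\<lbrakk>computable J; computable i\<rbrakk> \<Longrightarrow> computable (\<lambda>x. peer_of (J x) (i x))"
  unfolding peer_of_def by (intro computable_intros)

lemma computable_trans_of [computable_intros]:
  "\<lbrakk>computable J; computable i\<rbrakk> \<Longrightarrow> computable (\<lambda>x. trans_of (J x) (i x))"
  unfolding trans_of_def by (intro computable_intros)

lemma computable_peer_list [computable_intros]: "computable J \<Longrightarrow> computable (\<lambda>x. peer_list (J x))"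
  unfolding peer_list_def by (intro computable_intros)

lemma computable_initial [computable_intros]: "computable J \<Longrightarrow> computable (\<lambda>x. initial (J x))"
  by (rule computable_compose[of initial]) (unfold initial_def, intro computable_intros)

lemma computable_all_states [computable_intros]: "computable J \<Longrightarrow> computable (\<lambda>x. all_states (J x))"
  by (rule computable_compose[of all_states]) (unfold all_states_def, intro computable_intros)

lemma computable_next_states [computable_intros]:
  assumes "computable J" "computable D" "computable m"
  shows "computable (\<lambda>x. next_states (J x) (D x) (m x))"
proof -
  have "computable (\<lambda>p. next_states (fst p) (fst (snd p)) (snd (snd p)))"
    unfolding next_states_def by (intro computable_intros)
  from computable_compose[OF this, of "\<lambda>x. (J x, D x, m x)"] show ?thesis
    by (simp add: computable_Pair assms)
qed

lemma computable_live_list [computable_intros]: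
  assumes "computable J" "computable D" shows "computable (\<lambda>x. live_list (J x) (D x))"
proof -
  have "computable (\<lambda>p. live_list (fst p) (snd p))"
    unfolding live_list_def by (intro computable_intros)
  from computable_compose[OF this, of "\<lambda>x. (J x, D x)"] show ?thesis
    by (simp add: computable_Pair assms)
qed

lemma computable_good_list [computable_intros]:
  assumes "computable J" "computable D" shows "computable (\<lambda>x. good_list (J x) (D x))"
proof -
  have "computable (\<lambda>p. good_list (fst p) (snd p))"
    unfolding good_list_def by (intro computable_intros)
  from computable_compose[OF this, of "\<lambda>x. (J x, D x)"] show ?thesis
    by (simp add: computable_Pair assms)
qed

lemma computable_invariant: "computable (\<lambda>p. invariant (dec_system (fst p)) (dec (snd p)))"
  unfolding invariant_def
  by (intro computable_intros computable_compose[OF computable_dec_system])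

lemma computable_refutation: "computable (\<lambda>p. refutation (dec_system (fst p)) (dec (snd p)))"
  unfolding refutation_def
  by (intro computable_intros computable_compose[OF computable_dec_system])

section \<open>Agreement of the lists with the state families\<close>

lemma hd_funpow_tl: "k < length l \<Longrightarrow> hd ((tl ^^ k) l) = l ! k"
proof -
  have "(tl ^^ k) l = drop k l" by (induction k) (simp_all add: drop_Suc tl_drop)
  then show "k < length l \<Longrightarrow> hd ((tl ^^ k) l) = l ! k" by (simp add: hd_drop_conv_nth)
qed

lemma set_peer_list: "set (peer_list J) = {1..fst J}"
proof -
  have "k \<le> n \<Longrightarrow> fst (((\<lambda>p. (fst p - 1, fst p # snd p)) ^^ k) (n, [])) = n - k \<and>
      set (snd (((\<lambda>p. (fst p - 1, fst p # snd p)) ^^ k) (n, []))) = {n - k<..n}" for k n :: nat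
    by (induction k) auto
  from this[OF order_refl] have "set (peer_list J) = {fst J - fst J<..fst J}"
    unfolding peer_list_def by (rule conjunct2)
  then show ?thesis by (simp add: atLeastSucAtMost_greaterThanAtMost)
qed

locale valid_system =
  fixes I :: inst
  assumes valid: "valid_inst I"
begin

abbreviation "J \<equiv> (npeers I, msgs I, peers I)"

lemma peers_eq: "set (peer_list J) = {1..npeers I}"
  by (simp add: set_peer_list)

lemma peer_of_eq:
  assumes "i \<in> {1..npeers I}"
  shows "fst (peer_of J i) = init_st I i" "set (trans_of J i) = trans I i"
proof -
  have "peer_of J i = peers I ! (i - 1)"
    unfolding peer_of_def using assms valid by (auto simp: valid_inst_def intro!: hd_funpow_tl)
  then show "fst (peer_of J i) = init_st I i" "set (trans_of J i) = trans I i"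
    by (simp_all add: trans_of_def init_st_def trans_def)
qed

lemma msgs_props:
  assumes "m \<in> set (msgs I)"
  shows "fst m \<in> msg_set I" "src I (fst m) = fst (snd m)" "dst I (fst m) = snd (snd m)"
    "fst (snd m) \<in> {1..npeers I}" "snd (snd m) \<in> {1..npeers I}"
proof -
  obtain a p where m: "m = (a, p)" by (cases m)
  have "map_of (msgs I) a = Some p" using assms valid m by (simp add: valid_inst_def)
  then show "fst m \<in> msg_set I" "src I (fst m) = fst (snd m)" "dst I (fst m) = snd (snd m)"
    "fst (snd m) \<in> {1..npeers I}" "snd (snd m) \<in> {1..npeers I}"
    using assms valid m by (auto simp: msg_set_def src_def dst_def valid_inst_def rev_image_eqI)
qed

lemma msg_set_eq: "msg_set I = fst ` set (msgs I)"
  by (simp add: msg_set_def)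

text \<open>The bound by \<open>all_states J\<close> ensures that the filter in
  \<open>next_states\<close> does not drop states of peers that an exchange leaves alone.\<close>

definition sim :: "(nat \<times> nat) list \<Rightarrow> (nat \<Rightarrow> nat set) \<Rightarrow> bool" where
  "sim D E \<longleftrightarrow> set D \<subseteq> set (all_states J) \<and> (\<forall>i\<in>{1..npeers I}. \<forall>q. (i, q) \<in> set D \<longleftrightarrow> q \<in> E i)"

lemma sim_iff: "sim D E \<Longrightarrow> i \<in> {1..npeers I} \<Longrightarrow> (i, q) \<in> set D \<longleftrightarrow> q \<in> E i"
  by (simp add: sim_def)

lemma sim_initial: "sim (initial J) (sync_states I [])"
  by (auto simp: sim_def all_states_def initial_def peers_eq peer_of_eq image_iff)

lemma all_states_post:
  assumes "i \<in> {1..npeers I}" "q' \<in> post (trans I i) Q x" shows "(i, q') \<in> set (all_states J)"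
  using assms by (force simp: all_states_def peers_eq peer_of_eq post_def)

lemma sim_next:
  assumes s: "sim D E" and m: "m \<in> set (msgs I)"
  shows "sim (next_states J D m) (sync_step I E (fst m))"
  unfolding sim_def
proof (intro conjI ballI allI)
  show "set (next_states J D m) \<subseteq> set (all_states J)" by (auto simp: next_states_def)
  fix i q assume i: "i \<in> {1..npeers I}"
  have post: "(\<exists>d\<in>set D. fst d = i \<and> (snd d, x, q) \<in> set (trans_of J i)) \<longleftrightarrow> q \<in> post (trans I i) (E i) x" for x
    using sim_iff[OF s i] by (force simp: post_def peer_of_eq[OF i])
  have sub: "(i, q) \<in> set D \<Longrightarrow> (i, q) \<in> set (all_states J)" using s by (auto simp: sim_def)
  have "(i, q) \<in> set (next_states J D m) \<longleftrightarrow> (i, q) \<in> set (all_states J) \<and>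
      (if i = fst (snd m) then \<exists>d\<in>set D. fst d = i \<and> (snd d, Snd (fst m), q) \<in> set (trans_of J i)
       else if i = snd (snd m) then \<exists>d\<in>set D. fst d = i \<and> (snd d, Rcv (fst m), q) \<in> set (trans_of J i)
       else (i, q) \<in> set D)"
    unfolding next_states_def set_filter mem_Collect_eq fst_conv snd_conv by (rule refl)
  also have "\<dots> \<longleftrightarrow> q \<in> sync_step I E (fst m) i"
    unfolding post sync_step_def msgs_props(2,3)[OF m]
    using all_states_post[OF i, of q] sub sim_iff[OF s i, of q] by auto
  finally show "(i, q) \<in> set (next_states J D m) \<longleftrightarrow> q \<in> sync_step I E (fst m) i" .
qed

lemma sim_live: "sim D E \<Longrightarrow> live_list J D \<longleftrightarrow> live I E"
  unfolding live_list_def live_def peers_eq using sim_iff by (force intro!: ball_cong)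

lemma sim_good:
  assumes s: "sim D E" shows "good_list J D \<longleftrightarrow> good I E"
proof -
  have send: "(\<exists>d\<in>set D. fst d = i \<and> (\<exists>t\<in>set (trans_of J i). fst t = snd d \<and> fst (snd t) = x))
      \<longleftrightarrow> post (trans I i) (E i) x \<noteq> {}" if "i \<in> {1..npeers I}" for i x
    using sim_iff[OF s that] by (force simp: post_def peer_of_eq[OF that])
  have swap: "(\<forall>t\<in>set (trans_of J i). \<forall>t'\<in>set (trans_of J i).
           (i, fst t) \<in> set D \<and> fst (snd t) = x \<and> fst t' = snd (snd t) \<and> fst (snd t') = y
           \<longrightarrow> (i, snd (snd t')) \<in> set D') \<longleftrightarrow> posts (trans I i) (E i) [x, y] \<subseteq> E' i"
    if "i \<in> {1..npeers I}" "sim D' E'" for i x y D' E'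
    using sim_iff[OF s that(1)] sim_iff[OF that(2,1)] by (fastforce simp: post_def peer_of_eq[OF that(1)])
  \<comment> \<open>Both sides have the same logical shape, so congruence reduces the claim to the
    atomic tests, which \<open>sim_live\<close>, \<open>send\<close> and \<open>swap\<close>
    settle.\<close>
  show ?thesis
    unfolding good_list_def good_def msg_set_eq ball_simps fst_conv snd_conv
    by (intro arg_cong2[where f = "(\<longrightarrow>)"] arg_cong2[where f = "(\<and>)"] ball_cong refl)
      (assumption | rule refl sim_live sim_next s msgs_props
        | (simp only: msgs_props(2,3), rule send swap) | simp only: msgs_props(2,3))+
qed

lemma sim_foldl:
  "set u \<subseteq> set (msgs I) \<Longrightarrow> sim (foldl (next_states J) (initial J) u) (sync_states I (map fst u))"
proof (induction u rule: rev_induct)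
  case Nil
  then show ?case using sim_initial by simp
next
  case (snoc m u)
  then show ?case by (simp add: sync_states_snoc sim_next)
qed

lemma refutation_iff:
  "(\<exists>u. refutation J u) \<longleftrightarrow> (\<exists>u. set u \<subseteq> msg_set I \<and> \<not> good I (sync_states I u))"
proof
  assume "\<exists>u. refutation J u"
  then obtain u where u: "set u \<subseteq> set (msgs I)" "\<not> good_list J (foldl (next_states J) (initial J) u)"
    by (auto simp: refutation_def)
  then show "\<exists>u. set u \<subseteq> msg_set I \<and> \<not> good I (sync_states I u)"
    using sim_good[OF sim_foldl[OF u(1)]] by (intro exI[of _ "map fst u"]) (auto simp: msg_set_eq)
next
  assume "\<exists>u. set u \<subseteq> msg_set I \<and> \<not> good I (sync_states I u)"
  \<comment> \<open>A word of message names is the image of a word of entries of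
    \<open>msgs I\<close>, on which the list version operates.\<close>
  then obtain u where u: "u \<in> lists (fst ` set (msgs I))" "\<not> good I (sync_states I u)"
    by (auto simp: msg_set_eq)
  then obtain v where "v \<in> lists (set (msgs I))" "u = map fst v" unfolding lists_image by blast
  then show "\<exists>u. refutation J u"
    using sim_good[OF sim_foldl[of v]] u(2) by (intro exI[of _ v]) (auto simp: refutation_def)
qed

text \<open>A closed list of families contains every family reached by an exchange of messages, so
  all of these pass the test. Conversely the reached families form a finite set, and listing it
  gives the certificate.\<close>

lemma invariant_iff:
  "(\<exists>X. invariant J X) \<longleftrightarrow> (\<forall>u. set u \<subseteq> msg_set I \<longrightarrow> good I (sync_states I u))"
proof
  assume "\<exists>X. invariant J X"
  then obtain X where X: "invariant J X" by blast
  have "foldl (next_states J) (initial J) u \<in> set X" if "set u \<subseteq> set (msgs I)" for u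
    using that
  proof (induction u rule: rev_induct)
    case Nil
    then show ?case using X by (simp add: invariant_def)
  next
    case (snoc m u)
    then show ?case using X by (simp add: invariant_def)
  qed
  then have "\<not> refutation J u" for u using X by (auto simp: refutation_def invariant_def)
  then show "\<forall>u. set u \<subseteq> msg_set I \<longrightarrow> good I (sync_states I u)" using refutation_iff by blast
next
  assume g: "\<forall>u. set u \<subseteq> msg_set I \<longrightarrow> good I (sync_states I u)"
  let ?R = "{foldl (next_states J) (initial J) u |u. set u \<subseteq> set (msgs I)}"
  \<comment> \<open>A nonempty word ends with a filtering of \<open>all_states J\<close>, and the
    empty word yields \<open>initial J\<close>, an initial segment of it.\<close>
  have "?R \<subseteq> {l. set l \<subseteq> set (all_states J) \<and> length l \<le> length (all_states J)}"
  proof clarify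
    fix u :: "(nat \<times> nat \<times> nat) list"
    show "set (foldl (next_states J) (initial J) u) \<subseteq> set (all_states J) \<and>
        length (foldl (next_states J) (initial J) u) \<le> length (all_states J)"
    proof (cases u rule: rev_cases)
      case Nil
      then show ?thesis by (simp add: all_states_def)
    next
      case (snoc v m)
      then show ?thesis by (auto simp: next_states_def)
    qed
  qed
  then have "finite ?R" by (rule finite_subset) (rule finite_lists_length_le, simp)
  from finite_list[OF this] obtain X where X: "set X = ?R" ..
  have "good_list J D" "\<And>a. a \<in> set (msgs I) \<Longrightarrow> next_states J D a \<in> ?R" if D: "D \<in> ?R" for D
  proof -
    obtain u where u: "D = foldl (next_states J) (initial J) u" "set u \<subseteq> set (msgs I)" using D by blast
    show "good_list J D" unfolding u(1)
      using sim_good[OF sim_foldl[OF u(2)]] g[rule_format, of "map fst u"] u(2) by (auto simp: msg_set_eq)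
    show "next_states J D a \<in> ?R" if "a \<in> set (msgs I)" for a
      using u that by (auto intro!: exI[of _ "u @ [a]"])
  qed
  moreover have "initial J \<in> ?R" by (auto intro!: exI[of _ "[]"])
  ultimately have "invariant J X" unfolding invariant_def X by simp
  then show "\<exists>X. invariant J X" by blast
qed

end

theorem theorem4p16:
  shows "\<exists>f. \<forall>I. valid_inst I \<and> oriented_ring I \<longrightarrow>
           rec_eval f [enc_inst I] (if synchronizable I then 1 else 0)"
proof -
  \<comment> \<open>The same number \<open>n\<close> is read as a list of families by
    \<open>?P\<close> and as a word of messages by \<open>?Q\<close>; every number is a code for
    both types.\<close>
  let ?P = "\<lambda>x n. invariant (dec_system x) (dec n)" and ?Q = "\<lambda>x n. refutation (dec_system x) (dec n)"
  obtain f where f: "\<And>x. (\<exists>n. ?P x n) \<noteq> (\<exists>n. ?Q x n) \<Longrightarrow> rec_eval f [enc x] (if \<exists>n. ?P x n then 1 else 0)"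
    using computable_search[OF computable_invariant computable_refutation] by blast
  have "rec_eval f [enc_inst I] (if synchronizable I then 1 else 0)"
    if I: "valid_inst I" "oriented_ring I" for I
  proof -
    interpret ring_system I using oriented_ring_imp_ring_system[OF I] .
    interpret valid_system I by unfold_locales (rule I)
    \<comment> \<open>An invariant exists iff all families D(u) are good, and a refutation iff one
      is not. So exactly one of the two searches succeeds.\<close>
    have P: "(\<exists>n. ?P (enc_inst I) n) \<longleftrightarrow> synchronizable I"
      unfolding dec_system_enc_inst synchronizable_iff_good invariant_iff[symmetric] by (metis dec_enc)
    have Q: "(\<exists>n. ?Q (enc_inst I) n) \<longleftrightarrow> \<not> synchronizable I"
    proof -
      have "(\<exists>n. ?Q (enc_inst I) n) \<longleftrightarrow> (\<exists>u. refutation J u)"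
        unfolding dec_system_enc_inst by (metis dec_enc)
      then show ?thesis unfolding refutation_iff synchronizable_iff_good by blast
    qed
    show ?thesis using f[of "enc_inst I"] P Q by (simp add: enc_nat_def)
  qed
  then show ?thesis by blast
qed

end
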